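(* Let $t_0<t_1$ be real numbers, let $X$ be a Banach space, and let $\alpha>0$. The bounded operator $J^\alpha_{t_0,t}:L^\infty(t_0,t_1;X)\to L^\infty(t_0,t_1;X)$ is compact if and only if, for every bounded set $F\subset L^\infty(t_0,t_1;X)$ and every $t_0^*,t_1^*$ with $t_0<t_0^*<t_1^*<t_1$, the set $$\left\{J^{1+\alpha}_{t_0,t_1^*}f(t_1^* )-J^{1+\alpha}_{t_0,t_0^*}f(t_0^* )\,:\,f\in F\right\}$$ is relatively compact in $X$.
   Context: $L^\infty(t_0,t_1;X)$ is the Bochner-Lebesgue space of (classes of) essentially bounded Bochner measurable functions on $[t_0,t_1]$ with the essential supremum norm. For $\beta>0$, the Riemann-Liouville fractional integral of order $\beta$ is $J^\beta_{t_0,t}f(t):=\frac{1}{\Gamma(\beta)}\int_{t_0}^t(t-s)^{\beta-1}f(s)\,ds$ (Bochner integral); $J^{\beta}_{t_0,t^*}f(t^* )$ denotes its value at $t=t^*$. $J^\alpha_{t_0,t}$ as an operator sends $f$ to the function $t\mapsto J^\alpha_{t_0,t}f(t)$; it is a bounded linear operator from $L^\infty(t_0,t_1;X)$ into itself. *)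

theory Defs
  imports "HOL-Analysis.Analysis" "HOL-Probability.Essential_Supremum"
begin

text \<open>
  The Bochner integral of the library is restricted to second countable (i.e. separable)
  target spaces.  As the Banach space here is arbitrary, measurability and the integral are
  defined for all Banach spaces, by approximation with the library's simple functions.
\<close>

definition bochner_measurable :: "'a measure \<Rightarrow> ('a \<Rightarrow> 'b::real_normed_vector) \<Rightarrow> bool" where
  "bochner_measurable M f \<longleftrightarrow>
     (\<exists>s. (\<forall>i. simple_function M (s i)) \<and> (AE x in M. (\<lambda>i. s i x) \<longlonglongrightarrow> f x))"

definition has_bochner_value :: "'a measure \<Rightarrow> ('a \<Rightarrow> 'b::real_normed_vector) \<Rightarrow> 'b \<Rightarrow> bool" where
  "has_bochner_value M f v \<longleftrightarrow> bochner_measurable M f \<and>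
     (\<exists>s. (\<forall>i. Bochner_Integration.simple_bochner_integrable M (s i)) \<and>
          (\<lambda>i. \<integral>\<^sup>+ x. norm (f x - s i x) \<partial>M) \<longlonglongrightarrow> 0 \<and>
          (\<lambda>i. Bochner_Integration.simple_bochner_integral M (s i)) \<longlonglongrightarrow> v)"

definition bochner_integral :: "'a measure \<Rightarrow> ('a \<Rightarrow> 'b::real_normed_vector) \<Rightarrow> 'b" where
  "bochner_integral M f =
     (if \<exists>v. has_bochner_value M f v then THE v. has_bochner_value M f v else 0)"

text \<open>
  Elements of \<open>L\<^sup>\<infinity>\<close> are equivalence classes, i.e. sets of functions that agree almost
  everywhere; \<open>linf_norm\<close> is the seminorm on representatives.
\<close>

definition linf_funs :: "'a measure \<Rightarrow> ('a \<Rightarrow> 'b::real_normed_vector) set" where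
  "linf_funs M = {f. bochner_measurable M f \<and> esssup M (\<lambda>x. ereal (norm (f x))) < \<infinity>}"

definition linf_norm :: "'a measure \<Rightarrow> ('a \<Rightarrow> 'b::real_normed_vector) \<Rightarrow> real" where
  "linf_norm M f = real_of_ereal (esssup M (\<lambda>x. ereal (norm (f x))))"

definition linf_rel :: "'a measure \<Rightarrow> (('a \<Rightarrow> 'b::real_normed_vector) \<times> ('a \<Rightarrow> 'b)) set" where
  "linf_rel M = {(f, g). f \<in> linf_funs M \<and> g \<in> linf_funs M \<and> (AE x in M. f x = g x)}"

definition Linf :: "'a measure \<Rightarrow> ('a \<Rightarrow> 'b::real_normed_vector) set set" where
  "Linf M = linf_funs M // linf_rel M"

definition Linf_dist ::
    "'a measure \<Rightarrow> ('a \<Rightarrow> 'b::real_normed_vector) set \<Rightarrow> ('a \<Rightarrow> 'b) set \<Rightarrow> real" where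
  "Linf_dist M A B = linf_norm M (\<lambda>x. (SOME f. f \<in> A) x - (SOME g. g \<in> B) x)"

definition relatively_compactin :: "'a topology \<Rightarrow> 'a set \<Rightarrow> bool" where
  "relatively_compactin T S \<longleftrightarrow> S \<subseteq> topspace T \<and> compactin T (T closure_of S)"

definition compact_operator ::
    "'a set \<Rightarrow> ('a \<Rightarrow> 'a \<Rightarrow> real) \<Rightarrow> 'b set \<Rightarrow> ('b \<Rightarrow> 'b \<Rightarrow> real) \<Rightarrow> ('a \<Rightarrow> 'b) \<Rightarrow> bool" where
  "compact_operator M d N e T \<longleftrightarrow>
     (\<forall>F. Metric_space.mbounded M d F \<longrightarrow> relatively_compactin (Metric_space.mtopology N e) (T ` F))"

definition rl_integral :: "real \<Rightarrow> real \<Rightarrow> (real \<Rightarrow> 'b::real_normed_vector) \<Rightarrow> real \<Rightarrow> 'b" where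
  "rl_integral t0 \<beta> f t =
     (1 / Gamma \<beta>) *\<^sub>R bochner_integral (lebesgue_on {t0..t}) (\<lambda>s. (t - s) powr (\<beta> - 1) *\<^sub>R f s)"

text \<open>
  On classes, \<open>J\<^sup>\<beta>\<close> sends the class of \<open>f\<close> to the class of \<open>J\<^sup>\<beta> f\<close>.
\<close>

definition rl_operator ::
    "real \<Rightarrow> real \<Rightarrow> real \<Rightarrow> (real \<Rightarrow> 'b::real_normed_vector) set \<Rightarrow> (real \<Rightarrow> 'b) set" where
  "rl_operator t0 t1 \<beta> A = linf_rel (lebesgue_on {t0..t1}) `` (rl_integral t0 \<beta> ` A)"

lemma bochner_measurable_diff:
  assumes "bochner_measurable M f" "bochner_measurable M g"
  shows "bochner_measurable M (\<lambda>x. f x - g x)"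
proof -
  obtain s where s: "\<And>i. simple_function M (s i)" "AE x in M. (\<lambda>i. s i x) \<longlonglongrightarrow> f x"
    using assms(1) by (auto simp: bochner_measurable_def)
  obtain r where r: "\<And>i. simple_function M (r i)" "AE x in M. (\<lambda>i. r i x) \<longlonglongrightarrow> g x"
    using assms(2) by (auto simp: bochner_measurable_def)
  have "simple_function M (\<lambda>x. s i x - r i x)" for i
    using s(1) r(1) by (rule simple_function_compose2)
  moreover have "AE x in M. (\<lambda>i. s i x - r i x) \<longlonglongrightarrow> f x - g x"
    using s(2) r(2) by eventually_elim (rule tendsto_diff)
  ultimately show ?thesis
    unfolding bochner_measurable_def by (intro exI[of _ "\<lambda>i x. s i x - r i x"]) auto
qed

lemma bochner_measurable_norm:
  fixes f :: "real \<Rightarrow> 'b::real_normed_vector"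
  assumes "bochner_measurable (lebesgue_on {a..b}) f"
  shows "(\<lambda>x. ereal (norm (f x))) \<in> borel_measurable (lebesgue_on {a..b})"
proof -
  let ?M = "lebesgue_on {a..b}"
  obtain s where s: "\<And>i. simple_function ?M (s i)" "AE x in ?M. (\<lambda>i. s i x) \<longlonglongrightarrow> f x"
    using assms by (auto simp: bochner_measurable_def)
  define h where "h x = limsup (\<lambda>i. ereal (norm (s i x)))" for x
  have "simple_function ?M (\<lambda>x. ereal (norm (s i x)))" for i
    using s(1) by (rule simple_function_compose1)
  then have meas: "h \<in> borel_measurable ?M"
    unfolding h_def by (intro borel_measurable_limsup borel_measurable_simple_function)
  have eq: "AE x in ?M. h x = ereal (norm (f x))"
    using s(2)
  proof eventually_elim
    case (elim x)
    have "(\<lambda>i. ereal (norm (s i x))) \<longlonglongrightarrow> ereal (norm (f x))"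
      using elim by (intro tendsto_intros)
    then show ?case
      unfolding h_def by (intro lim_imp_Limsup) auto
  qed
  obtain N where hN: "\<And>x. x \<in> space ?M - N \<Longrightarrow> h x = ereal (norm (f x))"
      and N: "N \<in> null_sets ?M"
    by (rule AE_E3[OF eq]) (rule that)
  have null: "N \<inter> A \<in> sets ?M" for A
  proof -
    have "N \<in> null_sets lebesgue"
      using N by (subst (asm) null_sets_restrict_space) auto
    then have "N \<inter> A \<in> sets lebesgue"
      by (meson Int_lower1 null_sets_completion_subset null_setsD2)
    moreover have "N \<subseteq> {a..b}"
      using sets.sets_into_space[OF null_setsD2[OF N]] by (simp add: space_restrict_space)
    ultimately show ?thesis
      by (auto simp: sets_restrict_space_iff)
  qed
  show ?thesis
  proof (rule measurableI)
    fix A :: "ereal set" assume A: "A \<in> sets borel"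
    let ?g = "\<lambda>x. ereal (norm (f x))"
    have "h -` A \<inter> space ?M \<in> sets ?M"
      using meas A by (rule measurable_sets)
    moreover have "?g -` A \<inter> space ?M = (h -` A \<inter> space ?M - N) \<union> (N \<inter> (?g -` A))"
      using hN sets.sets_into_space[OF null_setsD2[OF N]] by fastforce
    ultimately show "?g -` A \<inter> space ?M \<in> sets ?M"
      using null null_setsD2[OF N] by (metis sets.Diff sets.Un)
  qed simp
qed

lemma bochner_measurable_cong_AE:
  assumes "AE x in M. f x = g x" "bochner_measurable M f"
  shows "bochner_measurable M g"
proof -
  obtain s where s: "\<And>i. simple_function M (s i)" "AE x in M. (\<lambda>i. s i x) \<longlonglongrightarrow> f x"
    using assms(2) by (auto simp: bochner_measurable_def)
  have "AE x in M. (\<lambda>i. s i x) \<longlonglongrightarrow> g x"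
    using s(2) assms(1) by eventually_elim simp
  then show ?thesis
    using s(1) by (auto simp: bochner_measurable_def)
qed

lemma bochner_integral_cong_AE:
  assumes fg: "AE x in M. f x = g x"
  shows "bochner_integral M f = bochner_integral M g"
proof -
  have gf: "AE x in M. g x = f x"
    using fg by eventually_elim simp
  have "(\<integral>\<^sup>+ x. norm (f x - s i x) \<partial>M) = (\<integral>\<^sup>+ x. norm (g x - s i x) \<partial>M)" for s and i :: nat
    using fg by (intro nn_integral_cong_AE) auto
  moreover have "bochner_measurable M f = bochner_measurable M g"
    using bochner_measurable_cong_AE[OF fg] bochner_measurable_cong_AE[OF gf] by blast
  ultimately have "has_bochner_value M f v = has_bochner_value M g v" for v
    by (simp add: has_bochner_value_def)
  then have "has_bochner_value M f = has_bochner_value M g"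
    by (rule ext)
  then show ?thesis
    by (simp add: bochner_integral_def)
qed

lemma rl_integral_cong_AE:
  assumes "AE x in lebesgue_on {t0..t1}. f x = g x" "t \<le> t1"
  shows "rl_integral t0 \<beta> f t = rl_integral t0 \<beta> g t"
proof -
  have "AE x in lebesgue_on {t0..t}. f x = g x"
    using assms by (auto simp: AE_restrict_space_iff elim: eventually_mono)
  then have "AE s in lebesgue_on {t0..t}.
      (t - s) powr (\<beta> - 1) *\<^sub>R f s = (t - s) powr (\<beta> - 1) *\<^sub>R g s"
    by eventually_elim simp
  then show ?thesis
    by (simp add: rl_integral_def bochner_integral_cong_AE)
qed

lemma equiv_linf_rel: "equiv (linf_funs M) (linf_rel M)"
proof (rule equivI)
  show "trans (linf_rel M)"
    unfolding linf_rel_def by (rule transI) (auto elim: eventually_elim2)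
  show "sym (linf_rel M)"
    unfolding linf_rel_def by (rule symI) (auto elim: eventually_mono)
qed (auto simp: linf_rel_def refl_on_def)

lemma Linf_rep:
  assumes "A \<in> Linf M"
  shows "(SOME f. f \<in> A) \<in> A" "A \<subseteq> linf_funs M"
    and "\<And>f g. f \<in> A \<Longrightarrow> g \<in> A \<Longrightarrow> AE x in M. f x = g x"
proof -
  have "A \<noteq> {}"
    using assms equiv_linf_rel in_quotient_imp_non_empty unfolding Linf_def by blast
  then show "(SOME f. f \<in> A) \<in> A"
    by (simp add: some_in_eq)
  show "A \<subseteq> linf_funs M"
    using assms equiv_linf_rel in_quotient_imp_subset unfolding Linf_def by blast
  show "AE x in M. f x = g x" if "f \<in> A" "g \<in> A" for f g
    using quotient_eq_iff[OF equiv_linf_rel, of A M A f g] that assms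
    by (auto simp: Linf_def linf_rel_def)
qed

lemma rl_operator_rep:
  assumes "A \<in> Linf (lebesgue_on {t0..t1})" "f \<in> A"
  shows "rl_operator t0 t1 \<beta> A = linf_rel (lebesgue_on {t0..t1}) `` {rl_integral t0 \<beta> f}"
proof -
  let ?M = "lebesgue_on {t0..t1}"
  have eq: "rl_integral t0 \<beta> g x = rl_integral t0 \<beta> f x" if "g \<in> A" "x \<in> space ?M" for g x
    using rl_integral_cong_AE Linf_rep(3)[OF assms(1) that(1) assms(2)] that(2) by fastforce
  have "(rl_integral t0 \<beta> f, h) \<in> linf_rel ?M" if "g \<in> A" "(rl_integral t0 \<beta> g, h) \<in> linf_rel ?M" for g h
  proof -
    have 1: "AE x in ?M. rl_integral t0 \<beta> g x = rl_integral t0 \<beta> f x"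
      using eq[OF that(1)] by (rule AE_I2)
    have "bochner_measurable ?M (rl_integral t0 \<beta> f)"
      using bochner_measurable_cong_AE[OF 1] that(2) by (simp add: linf_rel_def linf_funs_def)
    moreover have "esssup ?M (\<lambda>x. ereal (norm (rl_integral t0 \<beta> f x)))
        = esssup ?M (\<lambda>x. ereal (norm (rl_integral t0 \<beta> g x)))"
      using 1 calculation that(2)
      by (intro esssup_AE_cong bochner_measurable_norm) (auto simp: linf_rel_def linf_funs_def)
    moreover have "AE x in ?M. rl_integral t0 \<beta> f x = h x"
      using 1 that(2) by (auto simp: linf_rel_def)
    ultimately show ?thesis
      using that(2) by (auto simp: linf_rel_def linf_funs_def)
  qed
  then show ?thesis
    using assms(2) by (auto simp: rl_operator_def)
qed

context
  fixes a b :: real and M :: "real measure"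
  assumes ab: "a < b" and M_def: "M = lebesgue_on {a..b}"
begin

lemma emeasure_interval_nonzero: "emeasure M (space M) \<noteq> 0"
  using ab by (simp add: M_def emeasure_restrict_space)

lemma esssup_norm_ge_0: "0 \<le> esssup M (\<lambda>x. ereal (norm (f x)))"
proof -
  have "esssup M (\<lambda>x. 0) \<le> esssup M (\<lambda>x. ereal (norm (f x)))"
    by (intro esssup_mono) auto
  then show ?thesis
    by (simp add: esssup_const emeasure_interval_nonzero)
qed

lemma esssup_eq_linf_norm:
  assumes "f \<in> linf_funs M"
  shows "esssup M (\<lambda>x. ereal (norm (f x))) = ereal (linf_norm M f)"
  using assms esssup_norm_ge_0[of f] by (auto simp: linf_funs_def linf_norm_def ereal_real)

lemma linf_norm_AE:
  assumes "f \<in> linf_funs M"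
  shows "AE x in M. norm (f x) \<le> linf_norm M f"
  using esssup_AE[of "\<lambda>x. ereal (norm (f x))" M] by (simp add: esssup_eq_linf_norm[OF assms])

lemma linf_norm_I:
  assumes "bochner_measurable M f" "AE x in M. norm (f x) \<le> c"
  shows "f \<in> linf_funs M" "linf_norm M f \<le> c"
proof -
  have *: "esssup M (\<lambda>x. ereal (norm (f x))) \<le> ereal c"
    using assms bochner_measurable_norm unfolding M_def by (intro esssup_I) auto
  also have "\<dots> < \<infinity>"
    by simp
  finally show "f \<in> linf_funs M"
    using assms(1) by (simp add: linf_funs_def)
  from esssup_eq_linf_norm[OF this] * show "linf_norm M f \<le> c"
    by simp
qed

lemma linf_norm_ge_0: "0 \<le> linf_norm M f"
  using esssup_norm_ge_0[of f] by (simp add: linf_norm_def real_of_ereal_pos)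

lemma linf_diff:
  assumes "f \<in> linf_funs M" "g \<in> linf_funs M"
  shows "(\<lambda>x. f x - g x) \<in> linf_funs M"
proof (rule linf_norm_I(1))
  show "bochner_measurable M (\<lambda>x. f x - g x)"
    using assms by (intro bochner_measurable_diff) (auto simp: linf_funs_def)
  show "AE x in M. norm (f x - g x) \<le> linf_norm M f + linf_norm M g"
    using linf_norm_AE[OF assms(1)] linf_norm_AE[OF assms(2)]
    by eventually_elim (meson add_mono norm_triangle_ineq4 order_trans)
qed

lemma Linf_dist_eq:
  assumes "A \<in> Linf M" "B \<in> Linf M" "f \<in> A" "g \<in> B"
  shows "Linf_dist M A B = linf_norm M (\<lambda>x. f x - g x)"
proof -
  let ?f = "SOME f. f \<in> A" and ?g = "SOME g. g \<in> B"
  note A = Linf_rep[OF assms(1)] and B = Linf_rep[OF assms(2)]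
  have "bochner_measurable M (\<lambda>x. u x - v x)" if "u \<in> A" "v \<in> B" for u v
    using linf_diff[OF subsetD[OF A(2) that(1)] subsetD[OF B(2) that(2)]]
    by (simp add: linf_funs_def)
  note meas = bochner_measurable_norm[OF this[unfolded M_def], folded M_def]
  have "AE x in M. ereal (norm (?f x - ?g x)) = ereal (norm (f x - g x))"
    using A(3)[OF A(1) assms(3)] B(3)[OF B(1) assms(4)] by eventually_elim simp
  from esssup_AE_cong[OF meas[OF A(1) B(1)] meas[OF assms(3,4)] this] show ?thesis
    by (simp only: Linf_dist_def linf_norm_def)
qed

lemma Metric_space_Linf:
  "Metric_space (Linf M :: (real \<Rightarrow> 'b::real_normed_vector) set set) (Linf_dist M)"
proof
  fix A B :: "(real \<Rightarrow> 'b) set"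
  show "0 \<le> Linf_dist M A B"
    by (simp add: Linf_dist_def linf_norm_ge_0)
  show "Linf_dist M A B = Linf_dist M B A"
    by (simp add: Linf_dist_def linf_norm_def norm_minus_commute)
next
  fix A B :: "(real \<Rightarrow> 'b) set"
  assume AB: "A \<in> Linf M" "B \<in> Linf M"
  obtain f g where fg: "f \<in> A" "g \<in> B"
    by (rule that[OF Linf_rep(1)[OF AB(1)] Linf_rep(1)[OF AB(2)]])
  then have fg': "f \<in> linf_funs M" "g \<in> linf_funs M"
    using Linf_rep(2)[OF AB(1)] Linf_rep(2)[OF AB(2)] by auto
  have d: "Linf_dist M A B = linf_norm M (\<lambda>x. f x - g x)"
    by (rule Linf_dist_eq[OF AB fg])
  show "Linf_dist M A B = 0 \<longleftrightarrow> A = B"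
  proof
    assume "Linf_dist M A B = 0"
    then have "AE x in M. f x = g x"
      using linf_norm_AE[OF linf_diff[OF fg']] d by simp
    then have "(f, g) \<in> linf_rel M"
      using fg' by (simp add: linf_rel_def)
    then show "A = B"
      by (rule quotient_eqI[OF equiv_linf_rel AB[unfolded Linf_def] fg])
  next
    assume "A = B"
    then have "f \<in> B"
      using fg(1) by simp
    then have "Linf_dist M A B = linf_norm M (\<lambda>x. f x - f x)"
      by (rule Linf_dist_eq[OF AB fg(1)])
    also have "\<dots> = linf_norm M (\<lambda>x. 0 :: 'b)"
      by simp
    also have "\<dots> = 0"
      by (simp add: linf_norm_def esssup_const emeasure_interval_nonzero)
    finally show "Linf_dist M A B = 0" .
  qed
next
  fix A B C :: "(real \<Rightarrow> 'b) set"
  assume ABC: "A \<in> Linf M" "B \<in> Linf M" "C \<in> Linf M"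
  obtain f g h where fgh: "f \<in> A" "g \<in> B" "h \<in> C"
    by (rule that[OF Linf_rep(1)[OF ABC(1)] Linf_rep(1)[OF ABC(2)] Linf_rep(1)[OF ABC(3)]])
  then have fgh': "f \<in> linf_funs M" "g \<in> linf_funs M" "h \<in> linf_funs M"
    using Linf_rep(2)[OF ABC(1)] Linf_rep(2)[OF ABC(2)] Linf_rep(2)[OF ABC(3)] by auto
  have "AE x in M. norm (f x - h x) \<le> linf_norm M (\<lambda>x. f x - g x) + linf_norm M (\<lambda>x. g x - h x)"
    using linf_norm_AE[OF linf_diff[OF fgh'(1,2)]] linf_norm_AE[OF linf_diff[OF fgh'(2,3)]]
  proof eventually_elim
    case (elim x)
    then show ?case
      using norm_triangle_ineq[of "f x - g x" "g x - h x"] by simp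
  qed
  then have "linf_norm M (\<lambda>x. f x - h x) \<le> linf_norm M (\<lambda>x. f x - g x) + linf_norm M (\<lambda>x. g x - h x)"
    using linf_diff[OF fgh'(1,3)] by (intro linf_norm_I(2)) (auto simp: linf_funs_def)
  then show "Linf_dist M A C \<le> Linf_dist M A B + Linf_dist M B C"
    using Linf_dist_eq[OF ABC(1,3) fgh(1,3)] Linf_dist_eq[OF ABC(1,2) fgh(1,2)]
      Linf_dist_eq[OF ABC(2,3) fgh(2,3)] by simp
qed

end

end

theory Submission
  imports Defs
begin

text \<open>
  Write \<open>k\<^sub>t\<close> for the kernel \<open>s \<mapsto> (t - s)\<^bsup>\<alpha> - 1\<^esup> / \<Gamma>(\<alpha>)\<close>, extended by zero to \<open>s \<ge> t\<close>. It depends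
  continuously on \<open>t\<close> in \<open>L\<^sup>1\<close>, and a Bochner integral \<open>\<integral> k f\<close> is bounded by the \<open>L\<^sup>1\<close> norm of \<open>k\<close> times
  the essential bound of \<open>f\<close>. Therefore \<open>J\<^sup>\<alpha>\<close> sends a bounded set of functions \<open>f\<close> to an equicontinuous set
  of continuous functions. Moreover \<open>J\<^bsup>1 + \<alpha>\<^esup> f\<close> is differentiable with derivative \<open>J\<^sup>\<alpha> f\<close>, and the remainder of
  the difference quotient is small uniformly over the bounded set. Both statements are \<open>L\<^sup>1\<close> estimates
  for scalar kernels (\<open>rl_kernel_L1_equicontinuous\<close> and \<open>rl_kernel_first_order\<close>), collected in
  \<open>rl_integral_equicontinuous_derivative\<close>.

  If \<open>J\<^sup>\<alpha>\<close> is compact, the functions \<open>J\<^sup>\<alpha> f\<close> have finite nets in the supremum norm. These are the derivatives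
  of \<open>J\<^bsup>1 + \<alpha>\<^esup> f\<close>, so the mean value inequality makes them finite nets for the increments of \<open>J\<^bsup>1 + \<alpha>\<^esup> f\<close>, and
  completeness of the Banach space gives relative compactness
  (\<open>increments_compact_if_rl_operator_image_compact\<close>).

  Conversely, if all increments are relatively compact, then up to a small error so are the difference
  quotients, and hence the values of \<open>J\<^sup>\<alpha> f\<close> at each point of a finite grid. Equicontinuity extends
  this to the whole interval as in the Arzela-Ascoli theorem (\<open>finite_uniform_net_if_increments_compact\<close>),
  so the functions \<open>J\<^sup>\<alpha> f\<close> are totally bounded in the complete space of bounded continuous functions. The
  map to \<open>L\<^sup>\<infinity>\<close> is continuous and preserves compactness (\<open>relatively_compactin_Linf_class\<close>).
\<close>

section \<open>The Bochner integral over an interval\<close>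

lemma simple_function_imp_bochner_measurable:
  "simple_function M s \<Longrightarrow> bochner_measurable M s"
  unfolding bochner_measurable_def by (intro exI[of _ "\<lambda>_. s"]) simp

lemma bochner_measurable_scaleR:
  fixes k :: "'a \<Rightarrow> real"
  assumes k: "k \<in> borel_measurable M" and f: "bochner_measurable M f"
  shows "bochner_measurable M (\<lambda>x. k x *\<^sub>R f x)"
proof -
  obtain r where r: "\<And>i. simple_function M (r i)" "\<And>x. x \<in> space M \<Longrightarrow> (\<lambda>i. r i x) \<longlonglongrightarrow> k x"
    using borel_measurable_implies_sequence_metric[OF k, of 0] by metis
  obtain s where s: "\<And>i. simple_function M (s i)" "AE x in M. (\<lambda>i. s i x) \<longlonglongrightarrow> f x"
    using f by (auto simp: bochner_measurable_def)
  have "simple_function M (\<lambda>x. r i x *\<^sub>R s i x)" for i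
    using r(1) s(1) by (rule simple_function_compose2)
  moreover have "AE x in M. (\<lambda>i. r i x *\<^sub>R s i x) \<longlonglongrightarrow> k x *\<^sub>R f x"
    using s(2) AE_space by eventually_elim (intro tendsto_scaleR r(2))
  ultimately show ?thesis
    unfolding bochner_measurable_def by (intro exI[of _ "\<lambda>i x. r i x *\<^sub>R s i x"]) auto
qed

lemma norm_simple_bochner_integral_le:
  assumes "Bochner_Integration.simple_bochner_integrable M s"
  shows "ennreal (norm (Bochner_Integration.simple_bochner_integral M s)) \<le> (\<integral>\<^sup>+ x. norm (s x) \<partial>M)"
proof -
  have "Bochner_Integration.simple_bochner_integrable M (\<lambda>x. norm (s x))"
    using simple_bochner_integrable_compose2[of "\<lambda>x y. norm x" M s s] assms by simp
  then have "ennreal (Bochner_Integration.simple_bochner_integral M (\<lambda>x. norm (s x))) = (\<integral>\<^sup>+ x. norm (s x) \<partial>M)"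
    by (intro simple_bochner_integral_eq_nn_integral) auto
  with simple_bochner_integral_norm_bound[OF assms] show ?thesis
    by (metis ennreal_leI)
qed

lemma tendsto_zero_ennreal_le:
  fixes u v :: "nat \<Rightarrow> ennreal"
  assumes "\<And>i. u i \<le> v i" "v \<longlonglongrightarrow> 0"
  shows "u \<longlonglongrightarrow> 0"
  by (rule tendsto_sandwich[OF _ _ tendsto_const assms(2)]) (simp_all add: assms(1))

lemma simple_bochner_integrableD:
  assumes "Bochner_Integration.simple_bochner_integrable M s"
  shows "simple_function M s" "bochner_measurable M s"
  using assms simple_function_imp_bochner_measurable by (auto elim: simple_bochner_integrable.cases)

context
  fixes a b :: real and M :: "real measure"
  assumes M_def: "M = lebesgue_on {a..b}"
begin

lemma norm_borel_measurable:
  "bochner_measurable M f \<Longrightarrow> (\<lambda>x. norm (f x)) \<in> borel_measurable M"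
  using bochner_measurable_norm[of a b f] by (simp add: M_def borel_measurable_ereal_iff)

lemma simple_bochner_integrable_interval:
  "simple_function M s \<Longrightarrow> Bochner_Integration.simple_bochner_integrable M s"
proof (rule simple_bochner_integrable.intros)
  have "emeasure M {y \<in> space M. s y \<noteq> 0} \<le> emeasure M (space M)"
    by (rule emeasure_space)
  also have "emeasure M (space M) < \<infinity>"
    by (simp add: M_def emeasure_restrict_space emeasure_lborel_Icc_eq)
  finally show "emeasure M {y \<in> space M. s y \<noteq> 0} \<noteq> \<infinity>" by simp
qed

lemma has_bochner_value_scaleR:
  assumes "has_bochner_value M f v"
  shows "has_bochner_value M (\<lambda>x. c *\<^sub>R f x) (c *\<^sub>R v)"
proof -
  obtain s where s: "\<And>i. Bochner_Integration.simple_bochner_integrable M (s i)"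
      "(\<lambda>i. \<integral>\<^sup>+ x. norm (f x - s i x) \<partial>M) \<longlonglongrightarrow> 0"
      "(\<lambda>i. Bochner_Integration.simple_bochner_integral M (s i)) \<longlonglongrightarrow> v"
    and f: "bochner_measurable M f"
    using assms by (auto simp: has_bochner_value_def)
  let ?r = "\<lambda>i x. c *\<^sub>R s i x"
  have "Bochner_Integration.simple_bochner_integrable M (?r i)" for i
    using simple_bochner_integrable_compose2[of "\<lambda>x y. c *\<^sub>R x" M "s i" "s i"] s(1) by simp
  moreover have "(\<lambda>i. \<integral>\<^sup>+ x. norm (c *\<^sub>R f x - ?r i x) \<partial>M) \<longlonglongrightarrow> 0"
  proof -
    have lim: "(\<lambda>i. ennreal \<bar>c\<bar> * (\<integral>\<^sup>+ x. norm (f x - s i x) \<partial>M)) \<longlonglongrightarrow> ennreal \<bar>c\<bar> * 0"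
      by (intro ennreal_tendsto_cmult s(2)) simp
    have le: "(\<integral>\<^sup>+ x. norm (c *\<^sub>R f x - ?r i x) \<partial>M) \<le> ennreal \<bar>c\<bar> * (\<integral>\<^sup>+ x. norm (f x - s i x) \<partial>M)" for i
    proof -
      have "(\<integral>\<^sup>+ x. norm (c *\<^sub>R f x - ?r i x) \<partial>M) = (\<integral>\<^sup>+ x. ennreal \<bar>c\<bar> * norm (f x - s i x) \<partial>M)"
        by (simp add: ennreal_mult flip: scaleR_diff_right)
      also have "\<dots> \<le> ennreal \<bar>c\<bar> * (\<integral>\<^sup>+ x. norm (f x - s i x) \<partial>M)"
        using norm_borel_measurable[OF bochner_measurable_diff[OF f simple_bochner_integrableD(2)[OF s(1)]]]
        by (subst nn_integral_cmult) auto
      finally show ?thesis .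
    qed
    show ?thesis
      using tendsto_zero_ennreal_le[OF le] lim by simp
  qed
  moreover have "(\<lambda>i. Bochner_Integration.simple_bochner_integral M (?r i)) \<longlonglongrightarrow> c *\<^sub>R v"
    using tendsto_scaleR[OF tendsto_const s(3), of c]
    by (simp add: simple_bochner_integral_linear[OF linear_scaleR s(1)])
  moreover have "bochner_measurable M (\<lambda>x. c *\<^sub>R f x)"
    using f by (intro bochner_measurable_scaleR) auto
  ultimately show ?thesis
    unfolding has_bochner_value_def by (intro conjI exI[of _ ?r]) auto
qed

lemma has_bochner_value_diff:
  assumes "has_bochner_value M f v" "has_bochner_value M g w"
  shows "has_bochner_value M (\<lambda>x. f x - g x) (v - w)"
proof -
  obtain s where s: "\<And>i. Bochner_Integration.simple_bochner_integrable M (s i)"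
      "(\<lambda>i. \<integral>\<^sup>+ x. norm (f x - s i x) \<partial>M) \<longlonglongrightarrow> 0"
      "(\<lambda>i. Bochner_Integration.simple_bochner_integral M (s i)) \<longlonglongrightarrow> v"
    and f: "bochner_measurable M f"
    using assms(1) by (auto simp: has_bochner_value_def)
  obtain r where r: "\<And>i. Bochner_Integration.simple_bochner_integrable M (r i)"
      "(\<lambda>i. \<integral>\<^sup>+ x. norm (g x - r i x) \<partial>M) \<longlonglongrightarrow> 0"
      "(\<lambda>i. Bochner_Integration.simple_bochner_integral M (r i)) \<longlonglongrightarrow> w"
    and g: "bochner_measurable M g"
    using assms(2) by (auto simp: has_bochner_value_def)
  let ?q = "\<lambda>i x. s i x - r i x"
  have "Bochner_Integration.simple_bochner_integrable M (?q i)" for i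
    using simple_bochner_integrable_compose2[of "(-)" M "s i" "r i"] s(1) r(1) by simp
  moreover have "(\<lambda>i. \<integral>\<^sup>+ x. norm (f x - g x - ?q i x) \<partial>M) \<longlonglongrightarrow> 0"
  proof -
    have lim: "(\<lambda>i. (\<integral>\<^sup>+ x. norm (f x - s i x) \<partial>M) + (\<integral>\<^sup>+ x. norm (g x - r i x) \<partial>M)) \<longlonglongrightarrow> 0 + 0"
      by (intro tendsto_add s(2) r(2))
    have le: "(\<integral>\<^sup>+ x. norm (f x - g x - ?q i x) \<partial>M)
        \<le> (\<integral>\<^sup>+ x. norm (f x - s i x) \<partial>M) + (\<integral>\<^sup>+ x. norm (g x - r i x) \<partial>M)" for i
    proof -
      have "(\<lambda>x. norm (f x - s i x)) \<in> borel_measurable M" "(\<lambda>x. norm (g x - r i x)) \<in> borel_measurable M"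
        using f g simple_bochner_integrableD(2)[OF s(1)] simple_bochner_integrableD(2)[OF r(1)]
        by (intro norm_borel_measurable bochner_measurable_diff; simp)+
      then have "(\<integral>\<^sup>+ x. norm (f x - s i x) \<partial>M) + (\<integral>\<^sup>+ x. norm (g x - r i x) \<partial>M)
          = (\<integral>\<^sup>+ x. ennreal (norm (f x - s i x)) + ennreal (norm (g x - r i x)) \<partial>M)"
        by (intro nn_integral_add[symmetric]) auto
      moreover have "norm (f x - g x - ?q i x) \<le> norm (f x - s i x) + norm (g x - r i x)" for x
        using norm_triangle_ineq4[of "f x - s i x" "g x - r i x"] by (simp add: algebra_simps)
      ultimately show ?thesis
        by (auto intro!: nn_integral_mono simp flip: ennreal_plus)
    qed
    show ?thesis
      using tendsto_zero_ennreal_le[OF le] lim by simp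
  qed
  moreover have "(\<lambda>i. Bochner_Integration.simple_bochner_integral M (?q i)) \<longlonglongrightarrow> v - w"
    using tendsto_diff[OF s(3) r(3)] s(1) r(1) by (simp add: simple_bochner_integral_diff)
  ultimately show ?thesis
    using bochner_measurable_diff[OF f g]
    unfolding has_bochner_value_def by (intro conjI exI[of _ ?q]) auto
qed

text \<open>
  The norm bound gives uniqueness of the value: two values of the same function differ by a value
  of the zero function.
\<close>

lemma has_bochner_value_norm_le:
  assumes "has_bochner_value M f v"
  shows "ennreal (norm v) \<le> (\<integral>\<^sup>+ x. norm (f x) \<partial>M)"
proof -
  obtain s where s: "\<And>i. Bochner_Integration.simple_bochner_integrable M (s i)"
      "(\<lambda>i. \<integral>\<^sup>+ x. norm (f x - s i x) \<partial>M) \<longlonglongrightarrow> 0"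
      "(\<lambda>i. Bochner_Integration.simple_bochner_integral M (s i)) \<longlonglongrightarrow> v"
    and f: "bochner_measurable M f"
    using assms by (auto simp: has_bochner_value_def)
  have bound: "ennreal (norm (Bochner_Integration.simple_bochner_integral M (s i)))
      \<le> (\<integral>\<^sup>+ x. norm (f x) \<partial>M) + (\<integral>\<^sup>+ x. norm (f x - s i x) \<partial>M)" for i
  proof -
    have "(\<lambda>x. norm (f x)) \<in> borel_measurable M" "(\<lambda>x. norm (f x - s i x)) \<in> borel_measurable M"
      using f simple_bochner_integrableD(2)[OF s(1)]
      by (intro norm_borel_measurable bochner_measurable_diff; simp)+
    then have "(\<integral>\<^sup>+ x. norm (f x) \<partial>M) + (\<integral>\<^sup>+ x. norm (f x - s i x) \<partial>M)
        = (\<integral>\<^sup>+ x. ennreal (norm (f x)) + ennreal (norm (f x - s i x)) \<partial>M)"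
      by (intro nn_integral_add[symmetric]) auto
    moreover have "norm (s i x) \<le> norm (f x) + norm (f x - s i x)" for x
      using norm_triangle_ineq4[of "f x" "f x - s i x"] by simp
    ultimately have "(\<integral>\<^sup>+ x. norm (s i x) \<partial>M) \<le> (\<integral>\<^sup>+ x. norm (f x) \<partial>M) + (\<integral>\<^sup>+ x. norm (f x - s i x) \<partial>M)"
      by (auto intro!: nn_integral_mono simp flip: ennreal_plus)
    then show ?thesis
      using norm_simple_bochner_integral_le[OF s(1)] order_trans by blast
  qed
  show ?thesis
  proof (rule tendsto_le[OF sequentially_bot])
    show "(\<lambda>i. (\<integral>\<^sup>+ x. norm (f x) \<partial>M) + (\<integral>\<^sup>+ x. norm (f x - s i x) \<partial>M)) \<longlonglongrightarrow> (\<integral>\<^sup>+ x. norm (f x) \<partial>M)"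
      using tendsto_add[OF tendsto_const s(2), of "\<integral>\<^sup>+ x. norm (f x) \<partial>M"] by simp
    show "(\<lambda>i. ennreal (norm (Bochner_Integration.simple_bochner_integral M (s i)))) \<longlonglongrightarrow> ennreal (norm v)"
      by (intro tendsto_ennrealI tendsto_norm s(3))
  qed (use bound in auto)
qed

lemma bochner_integral_eqI:
  assumes "has_bochner_value M f v"
  shows "bochner_integral M f = v"
proof -
  have "w = v" if "has_bochner_value M f w" for w
    using has_bochner_value_norm_le[OF has_bochner_value_diff[OF that assms]] by (simp add: ennreal_eq_0_iff)
  with assms have "(THE v. has_bochner_value M f v) = v"
    by (rule the_equality)
  moreover have "\<exists>v. has_bochner_value M f v"
    using assms by (rule exI)
  ultimately show ?thesis
    by (simp only: bochner_integral_def if_True)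
qed

text \<open>
  Bochner's criterion. Simple functions that converge almost everywhere need not converge in
  \<open>L\<^sup>1\<close>; setting them to zero wherever their norm exceeds \<open>2 * norm (f x)\<close> keeps the pointwise limit
  and provides the integrable majorant \<open>3 * norm (f x)\<close>. The integrals of the truncated functions are
  then Cauchy in the Banach space.
\<close>

lemma has_bochner_value_bochner_integral:
  fixes f :: "real \<Rightarrow> 'x::banach"
  assumes f: "bochner_measurable M f" and fin: "(\<integral>\<^sup>+ x. norm (f x) \<partial>M) < \<infinity>"
  shows "has_bochner_value M f (bochner_integral M f)"
proof -
  obtain s where s: "\<And>i. simple_function M (s i)" "AE x in M. (\<lambda>i. s i x) \<longlonglongrightarrow> f x"
    using f by (auto simp: bochner_measurable_def)
  define r where "r i x = (if norm (s i x) \<le> 2 * norm (f x) then s i x else 0)" for i x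
  note [measurable] = norm_borel_measurable[OF f]
  have r: "simple_function M (r i)" for i
  proof -
    have [measurable]: "(\<lambda>x. norm (s i x)) \<in> borel_measurable M"
      by (intro norm_borel_measurable simple_function_imp_bochner_measurable s)
    have "{x \<in> space M. norm (s i x) \<le> 2 * norm (f x)} \<in> sets M"
      by measurable
    then show ?thesis
      unfolding r_def using s(1) by (intro simple_function_If) auto
  qed
  have bm: "bochner_measurable M (\<lambda>x. f x - r i x)" for i
    by (intro bochner_measurable_diff f simple_function_imp_bochner_measurable r)
  have lim: "AE x in M. (\<lambda>i. r i x) \<longlonglongrightarrow> f x"
    using s(2)
  proof eventually_elim
    case (elim x)
    show ?case
    proof (cases "f x = 0")
      case True
      then have "r i x = 0" for i by (simp add: r_def)
      then show ?thesis using True by simp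
    next
      case False
      have "eventually (\<lambda>i. norm (s i x) < 2 * norm (f x)) sequentially"
        using order_tendstoD(2)[OF tendsto_norm[OF elim]] False by simp
      then have "eventually (\<lambda>i. s i x = r i x) sequentially"
        by eventually_elim (simp add: r_def)
      then show ?thesis
        using elim by (blast intro: Lim_transform_eventually)
    qed
  qed
  have conv: "(\<lambda>i. \<integral>\<^sup>+ x. norm (f x - r i x) \<partial>M) \<longlonglongrightarrow> (\<integral>\<^sup>+ x. 0 \<partial>M)"
  proof (rule nn_integral_dominated_convergence)
    show "AE x in M. ennreal (norm (f x - r i x)) \<le> ennreal (3 * norm (f x))" for i
    proof (intro AE_I2 ennreal_leI)
      fix x show "norm (f x - r i x) \<le> 3 * norm (f x)"
        using norm_triangle_ineq4[of "f x" "r i x"] by (auto simp: r_def split: if_splits)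
    qed
    show "(\<integral>\<^sup>+ x. ennreal (3 * norm (f x)) \<partial>M) < \<infinity>"
      using fin by (simp add: ennreal_mult nn_integral_cmult ennreal_mult_less_top)
    show "AE x in M. (\<lambda>i. ennreal (norm (f x - r i x))) \<longlonglongrightarrow> 0"
      using lim
    proof eventually_elim
      case (elim x)
      then have "(\<lambda>i. norm (f x - r i x)) \<longlonglongrightarrow> norm (f x - f x)"
        by (intro tendsto_intros)
      then have "(\<lambda>i. ennreal (norm (f x - r i x))) \<longlonglongrightarrow> ennreal 0"
        by (intro tendsto_ennrealI) simp
      then show ?case by simp
    qed
  qed (use norm_borel_measurable[OF bm] in auto)
  then have conv0: "(\<lambda>i. \<integral>\<^sup>+ x. norm (f x - r i x) \<partial>M) \<longlonglongrightarrow> 0"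
    by simp
  let ?I = "\<lambda>i. Bochner_Integration.simple_bochner_integral M (r i)"
  have sbi: "Bochner_Integration.simple_bochner_integrable M (r i)" for i
    by (rule simple_bochner_integrable_interval[OF r])
  have diff: "ennreal (norm (?I i - ?I j)) \<le> (\<integral>\<^sup>+ x. norm (f x - r i x) \<partial>M) + (\<integral>\<^sup>+ x. norm (f x - r j x) \<partial>M)" for i j
  proof -
    have "ennreal (norm (?I i - ?I j)) \<le> (\<integral>\<^sup>+ x. norm (r i x - r j x) \<partial>M)"
      using norm_simple_bochner_integral_le[OF simple_bochner_integrable_compose2[of "(-)", OF _ sbi sbi, of i j]]
      by (simp add: simple_bochner_integral_diff sbi)
    also have "\<dots> \<le> (\<integral>\<^sup>+ x. ennreal (norm (f x - r i x)) + ennreal (norm (f x - r j x)) \<partial>M)"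
    proof (rule nn_integral_mono)
      fix x
      have "norm (r i x - r j x) \<le> norm (f x - r i x) + norm (f x - r j x)"
        using norm_triangle_ineq4[of "f x - r j x" "f x - r i x"] by (simp add: algebra_simps)
      then show "ennreal (norm (r i x - r j x)) \<le> ennreal (norm (f x - r i x)) + ennreal (norm (f x - r j x))"
        by (simp flip: ennreal_plus)
    qed
    also have "\<dots> = (\<integral>\<^sup>+ x. norm (f x - r i x) \<partial>M) + (\<integral>\<^sup>+ x. norm (f x - r j x) \<partial>M)"
      using norm_borel_measurable[OF bm] by (intro nn_integral_add) auto
    finally show ?thesis .
  qed
  have "Cauchy ?I"
  proof (rule metric_CauchyI)
    fix e :: real assume "0 < e"
    then have "eventually (\<lambda>i. (\<integral>\<^sup>+ x. norm (f x - r i x) \<partial>M) < ennreal (e / 2)) sequentially"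
      using order_tendstoD(2)[OF conv0] by simp
    then obtain N where N: "\<And>i. i \<ge> N \<Longrightarrow> (\<integral>\<^sup>+ x. norm (f x - r i x) \<partial>M) < ennreal (e / 2)"
      by (auto simp: eventually_sequentially)
    have "dist (?I i) (?I j) < e" if "i \<ge> N" "j \<ge> N" for i j
    proof -
      have "ennreal (norm (?I i - ?I j)) < ennreal (e / 2) + ennreal (e / 2)"
        using diff add_strict_mono[OF N[OF that(1)] N[OF that(2)]] by (rule le_less_trans)
      also have "\<dots> = ennreal e"
        using \<open>0 < e\<close> by (simp flip: ennreal_plus)
      finally show ?thesis
        by (simp add: dist_norm ennreal_less_iff)
    qed
    then show "\<exists>N. \<forall>i\<ge>N. \<forall>j\<ge>N. dist (?I i) (?I j) < e" by blast
  qed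
  then obtain v where "?I \<longlonglongrightarrow> v"
    using Cauchy_convergent convergent_def by blast
  then have "has_bochner_value M f v"
    unfolding has_bochner_value_def using f sbi conv0 by blast
  then show ?thesis
    using bochner_integral_eqI by blast
qed

end

text \<open>
  The Riemann-Liouville integral at \<open>t\<close> is taken over \<open>{a..t}\<close>, a domain that moves with \<open>t\<close>. Extending
  the integrand by zero makes the domain fixed, so that all values of \<open>t\<close> can be compared.
\<close>

lemma has_bochner_value_subinterval:
  fixes a b t :: real
  assumes v: "has_bochner_value (lebesgue_on {a..b}) g v" and t: "t \<le> b"
    and zero: "\<And>x. x > t \<Longrightarrow> g x = 0"
  shows "has_bochner_value (lebesgue_on {a..t}) g v"
proof -
  let ?M = "lebesgue_on {a..b}" and ?N = "lebesgue_on {a..t}"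
  have N: "?N = restrict_space ?M {a..t}"
    using t by (simp add: restrict_restrict_space min_absorb2)
  have ts: "{a..t} \<inter> space ?M \<in> sets ?M"
    using t by (auto simp: sets_restrict_space_iff)
  obtain s where s: "\<And>i. Bochner_Integration.simple_bochner_integrable ?M (s i)"
      "(\<lambda>i. \<integral>\<^sup>+ x. norm (g x - s i x) \<partial>?M) \<longlonglongrightarrow> 0"
      "(\<lambda>i. Bochner_Integration.simple_bochner_integral ?M (s i)) \<longlonglongrightarrow> v"
    and g: "bochner_measurable ?M g"
    using v by (auto simp: has_bochner_value_def)
  let ?r = "\<lambda>i x. indicat_real {a..t} x *\<^sub>R s i x"
  have cut: "simple_function ?M (\<lambda>x. indicat_real {a..t} x *\<^sub>R q x)" if "simple_function ?M q" for q :: "real \<Rightarrow> 'a"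
  proof -
    have "{x \<in> space ?M. x \<in> {a..t}} \<in> sets ?M"
      using ts by (simp add: Int_def conj_commute)
    then have "simple_function ?M (\<lambda>x. if x \<in> {a..t} then q x else 0)"
      using that by (intro simple_function_If) auto
    then show ?thesis
      by (rule simple_function_cong[THEN iffD1, rotated]) (auto simp: indicator_def)
  qed
  have restr: "simple_function ?N q" if "simple_function ?M q" for q :: "real \<Rightarrow> 'a"
    unfolding N simple_function_restrict_space[OF ts] by (rule cut[OF that])
  have sf: "simple_function ?M (?r i)" for i
    by (rule cut[OF simple_bochner_integrableD(1)[OF s(1)]])
  have rint: "Bochner_Integration.simple_bochner_integrable ?M (?r i)" for i
    by (rule simple_bochner_integrable_interval[OF refl sf])
  then have sN: "Bochner_Integration.simple_bochner_integrable ?N (s i)" for i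
    unfolding N simple_bochner_integrable_restrict_space[OF ts] .
  have le: "(\<integral>\<^sup>+ x. norm (g x - ?r i x) \<partial>?M) \<le> (\<integral>\<^sup>+ x. norm (g x - s i x) \<partial>?M)" for i
    by (rule nn_integral_mono) (auto simp: indicator_def zero)
  have lim: "(\<lambda>i. \<integral>\<^sup>+ x. norm (g x - ?r i x) \<partial>?M) \<longlonglongrightarrow> 0"
    using tendsto_zero_ennreal_le[OF le s(2)] .
  have limN: "(\<lambda>i. \<integral>\<^sup>+ x. norm (g x - s i x) \<partial>?N) \<longlonglongrightarrow> 0"
  proof -
    have "(\<integral>\<^sup>+ x. norm (g x - s i x) \<partial>?N) \<le> (\<integral>\<^sup>+ x. norm (g x - s i x) \<partial>?M)" for i
      unfolding N nn_integral_restrict_space[OF ts]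
      by (rule nn_integral_mono) (auto simp: indicator_def)
    then show ?thesis
      using s(2) by (rule tendsto_zero_ennreal_le)
  qed
  \<comment> \<open>beyond \<open>t\<close> the simple functions approximate zero, so cutting them off does not change the limit\<close>
  have "(\<lambda>i. Bochner_Integration.simple_bochner_integral ?M (?r i)) \<longlonglongrightarrow> v"
  proof -
    have "ennreal (norm (Bochner_Integration.simple_bochner_integral ?M (s i) -
        Bochner_Integration.simple_bochner_integral ?M (?r i))) \<le> (\<integral>\<^sup>+ x. norm (g x - s i x) \<partial>?M)" for i
    proof -
      have "ennreal (norm (Bochner_Integration.simple_bochner_integral ?M (s i) -
          Bochner_Integration.simple_bochner_integral ?M (?r i))) \<le> (\<integral>\<^sup>+ x. norm (s i x - ?r i x) \<partial>?M)"
        using norm_simple_bochner_integral_le[OF simple_bochner_integrable_compose2[of "(-)", OF _ s(1) rint, of i i]]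
        by (simp add: simple_bochner_integral_diff s(1) rint)
      also have "\<dots> \<le> (\<integral>\<^sup>+ x. norm (g x - s i x) \<partial>?M)"
        by (rule nn_integral_mono) (auto simp: indicator_def zero)
      finally show ?thesis .
    qed
    then have "(\<lambda>i. ennreal (norm (Bochner_Integration.simple_bochner_integral ?M (s i) -
        Bochner_Integration.simple_bochner_integral ?M (?r i)))) \<longlonglongrightarrow> 0"
      using s(2) by (rule tendsto_zero_ennreal_le)
    then have "(\<lambda>i. Bochner_Integration.simple_bochner_integral ?M (s i) -
        Bochner_Integration.simple_bochner_integral ?M (?r i)) \<longlonglongrightarrow> 0"
      using tendsto_ennreal_iff[of _ sequentially 0] tendsto_norm_zero_iff by fastforce
    from tendsto_diff[OF s(3) this] show ?thesis by simp
  qed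
  moreover have "Bochner_Integration.simple_bochner_integral ?N (s i) = Bochner_Integration.simple_bochner_integral ?M (?r i)" for i
    using sN unfolding N by (rule simple_bochner_integral_restrict_space[OF ts])
  moreover have "bochner_measurable ?N g"
  proof -
    obtain q where q: "\<And>i. simple_function ?M (q i)" "AE x in ?M. (\<lambda>i. q i x) \<longlonglongrightarrow> g x"
      using g by (auto simp: bochner_measurable_def)
    have "AE x in ?N. (\<lambda>i. q i x) \<longlonglongrightarrow> g x"
      unfolding N using q(2) by (subst AE_restrict_space_iff[OF ts]) auto
    then show ?thesis
      using restr[OF q(1)] unfolding bochner_measurable_def by blast
  qed
  ultimately show ?thesis
    unfolding has_bochner_value_def using sN limN by (intro conjI exI[of _ s]) simp_all
qed

text \<open>
  For a fixed bounded \<open>f\<close>, the map \<open>k \<mapsto> \<integral> k f\<close> is linear in the scalar kernel and bounded by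
  the \<open>L\<^sup>1\<close> norm. This is the only property of the vector-valued integral that the later estimates use;
  the combination \<open>k - l - r m\<close> has the shape of a first-order Taylor remainder.
\<close>

lemma
  fixes f :: "real \<Rightarrow> 'x::banach"
  assumes M: "M = lebesgue_on {a..b}" and f: "bochner_measurable M f" and c: "AE x in M. norm (f x) \<le> c" "0 \<le> c"
  shows has_bochner_value_kernel: "integrable M k \<Longrightarrow>
      has_bochner_value M (\<lambda>x. k x *\<^sub>R f x) (bochner_integral M (\<lambda>x. k x *\<^sub>R f x))"
    and norm_bochner_integral_kernel_le: "integrable M k \<Longrightarrow> integrable M l \<Longrightarrow> integrable M m \<Longrightarrow>
      norm (bochner_integral M (\<lambda>x. k x *\<^sub>R f x) - bochner_integral M (\<lambda>x. l x *\<^sub>R f x)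
        - r *\<^sub>R bochner_integral M (\<lambda>x. m x *\<^sub>R f x)) \<le> c * (LINT x|M. \<bar>k x - l x - r * m x\<bar>)"
proof -
  have bound: "(\<integral>\<^sup>+ x. norm (k x *\<^sub>R f x) \<partial>M) \<le> ennreal (c * (LINT x|M. \<bar>k x\<bar>))" if k: "integrable M k" for k :: "real \<Rightarrow> real"
  proof -
    have "(\<integral>\<^sup>+ x. norm (k x *\<^sub>R f x) \<partial>M) \<le> (\<integral>\<^sup>+ x. ennreal (c * \<bar>k x\<bar>) \<partial>M)"
      using c(1) by (intro nn_integral_mono_AE) (auto elim!: eventually_mono intro!: ennreal_leI mult_left_mono simp: mult.commute[of c])
    also have "\<dots> = ennreal (c * (LINT x|M. \<bar>k x\<bar>))"
      using k c(2) by (subst nn_integral_eq_integral) auto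
    finally show ?thesis .
  qed
  show val: "has_bochner_value M (\<lambda>x. k x *\<^sub>R f x) (bochner_integral M (\<lambda>x. k x *\<^sub>R f x))"
    if "integrable M k" for k
    using le_less_trans[OF bound[OF that] ennreal_less_top] that
    by (intro has_bochner_value_bochner_integral[OF M] bochner_measurable_scaleR f) auto
  assume klm: "integrable M k" "integrable M l" "integrable M m"
  let ?d = "\<lambda>x. k x - l x - r * m x"
  have d: "integrable M ?d"
    using klm by simp
  have "has_bochner_value M (\<lambda>x. k x *\<^sub>R f x - l x *\<^sub>R f x - r *\<^sub>R (m x *\<^sub>R f x))
     (bochner_integral M (\<lambda>x. k x *\<^sub>R f x) - bochner_integral M (\<lambda>x. l x *\<^sub>R f x)
        - r *\<^sub>R bochner_integral M (\<lambda>x. m x *\<^sub>R f x))" (is "has_bochner_value M _ ?v")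
    by (intro has_bochner_value_diff[OF M] has_bochner_value_scaleR[OF M] val klm)
  then have "has_bochner_value M (\<lambda>x. ?d x *\<^sub>R f x) ?v"
    by (simp add: scaleR_diff_left)
  from order_trans[OF has_bochner_value_norm_le[OF M this] bound[OF d]]
  show "norm ?v \<le> c * (LINT x|M. \<bar>?d x\<bar>)"
    using c(2) by (simp add: ennreal_le_iff)
qed

section \<open>The Riemann-Liouville kernel\<close>

definition rl_kernel :: "real \<Rightarrow> real \<Rightarrow> real \<Rightarrow> real" where
  "rl_kernel \<beta> t s = (if s < t then (t - s) powr (\<beta> - 1) / Gamma \<beta> else 0)"

lemma rl_kernel_nonneg: "0 < \<beta> \<Longrightarrow> 0 \<le> rl_kernel \<beta> t s"
  by (simp add: rl_kernel_def Gamma_real_pos less_imp_le)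

lemma has_integral_powr_singularity:
  fixes c t \<beta> :: real
  assumes "0 < \<beta>" "c \<le> t"
  shows "((\<lambda>s. (t - s) powr (\<beta> - 1)) has_integral ((t - c) powr \<beta> / \<beta>)) {c..t}"
proof -
  have "((\<lambda>s. (t - s) powr (\<beta> - 1)) has_integral (- ((t - t) powr \<beta> / \<beta>) - - ((t - c) powr \<beta> / \<beta>))) {c..t}"
  proof (rule fundamental_theorem_of_calculus_interior)
    show "continuous_on {c..t} (\<lambda>s. - ((t - s) powr \<beta> / \<beta>))"
      using assms by (intro continuous_intros continuous_on_powr') auto
    fix x assume "x \<in> {c<..<t}"
    then have "((\<lambda>s. - ((t - s) powr \<beta> / \<beta>)) has_real_derivative (t - x) powr (\<beta> - 1)) (at x)"
      using assms by (auto intro!: derivative_eq_intros simp: powr_diff field_simps)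
    then show "((\<lambda>s. - ((t - s) powr \<beta> / \<beta>)) has_vector_derivative (t - x) powr (\<beta> - 1)) (at x)"
      by (simp add: has_real_derivative_iff_has_vector_derivative)
  qed (use assms in auto)
  then show ?thesis using assms by simp
qed

lemma rl_kernel_has_integral:
  assumes "0 < \<beta>" "a \<le> c" "c \<le> t" "t \<le> b"
  shows "((\<lambda>s. if s \<in> {c..t} then rl_kernel \<beta> t s else 0) has_integral
    ((t - c) powr \<beta> / (\<beta> * Gamma \<beta>))) {a..b}"
proof -
  have "((\<lambda>s. (t - s) powr (\<beta> - 1) * (1 / Gamma \<beta>)) has_integral ((t - c) powr \<beta> / \<beta> * (1 / Gamma \<beta>))) {c..t}"
    using assms by (intro has_integral_mult_left has_integral_powr_singularity)
  then have "(rl_kernel \<beta> t has_integral ((t - c) powr \<beta> / (\<beta> * Gamma \<beta>))) {c..t}"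
    by (subst has_integral_cong[of _ _ "\<lambda>s. (t - s) powr (\<beta> - 1) * (1 / Gamma \<beta>)"])
       (auto simp: rl_kernel_def)
  then show ?thesis
    using assms by (subst has_integral_restrict) auto
qed

lemma integral_lebesgue_on_nonneg:
  fixes f :: "real \<Rightarrow> real"
  assumes I: "(f has_integral I) {a..b}" and nn: "\<And>x. 0 \<le> f x"
  shows "integrable (lebesgue_on {a..b}) f" "integral\<^sup>L (lebesgue_on {a..b}) f = I"
proof -
  have "f absolutely_integrable_on {a..b}"
    using I nn by (intro nonnegative_absolutely_integrable_1) auto
  then show "integrable (lebesgue_on {a..b}) f"
    by (rule absolutely_integrable_imp_integrable) simp
  then show "integral\<^sup>L (lebesgue_on {a..b}) f = I"
    using I by (simp add: lebesgue_integral_eq_integral integral_unique)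
qed

lemma
  assumes "0 < \<beta>" "a \<le> t" "t \<le> b"
  shows integrable_rl_kernel: "integrable (lebesgue_on {a..b}) (rl_kernel \<beta> t)"
    and integral_rl_kernel: "integral\<^sup>L (lebesgue_on {a..b}) (rl_kernel \<beta> t) = (t - a) powr \<beta> / (\<beta> * Gamma \<beta>)"
proof -
  have "(rl_kernel \<beta> t has_integral ((t - a) powr \<beta> / (\<beta> * Gamma \<beta>))) {a..b}"
    using rl_kernel_has_integral[OF assms(1) order_refl assms(2,3)]
    by (rule has_integral_eq[rotated]) (auto simp: rl_kernel_def)
  from integral_lebesgue_on_nonneg[OF this] show "integrable (lebesgue_on {a..b}) (rl_kernel \<beta> t)"
    "integral\<^sup>L (lebesgue_on {a..b}) (rl_kernel \<beta> t) = (t - a) powr \<beta> / (\<beta> * Gamma \<beta>)"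
    using rl_kernel_nonneg[OF assms(1)] by auto
qed

text \<open>
  The difference of two kernels has constant sign where both are nonzero. For \<open>\<alpha> \<ge> 1\<close> it is nonnegative
  everywhere, so its \<open>L\<^sup>1\<close> norm is the difference of the integrals. For \<open>\<alpha> < 1\<close> it is nonpositive before
  \<open>t\<close> and nonnegative after \<open>t\<close>; correcting the sign on \<open>{t..\<tau>}\<close> costs twice the mass there.
\<close>

lemma rl_kernel_L1_dist_le:
  assumes \<alpha>: "0 < \<alpha>" and t: "a \<le> t" "t \<le> \<tau>" "\<tau> \<le> b"
  shows "(LINT s|lebesgue_on {a..b}. \<bar>rl_kernel \<alpha> \<tau> s - rl_kernel \<alpha> t s\<bar>)
    \<le> (\<bar>(\<tau> - a) powr \<alpha> - (t - a) powr \<alpha>\<bar> + 2 * (\<tau> - t) powr \<alpha>) / (\<alpha> * Gamma \<alpha>)"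
proof -
  let ?M = "lebesgue_on {a..b}" and ?g = "\<lambda>s. if s \<in> {t..\<tau>} then rl_kernel \<alpha> \<tau> s else 0"
  have pos: "0 < \<alpha> * Gamma \<alpha>"
    using \<alpha> by (simp add: Gamma_real_pos)
  have i: "integrable ?M (rl_kernel \<alpha> \<tau>)" "integrable ?M (rl_kernel \<alpha> t)"
    using \<alpha> t by (intro integrable_rl_kernel; simp)+
  have v: "integral\<^sup>L ?M (rl_kernel \<alpha> \<tau>) = (\<tau> - a) powr \<alpha> / (\<alpha> * Gamma \<alpha>)"
    "integral\<^sup>L ?M (rl_kernel \<alpha> t) = (t - a) powr \<alpha> / (\<alpha> * Gamma \<alpha>)"
    using \<alpha> t by (intro integral_rl_kernel; simp)+
  have g: "integrable ?M ?g" "integral\<^sup>L ?M ?g = (\<tau> - t) powr \<alpha> / (\<alpha> * Gamma \<alpha>)"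
    by (rule integral_lebesgue_on_nonneg[OF rl_kernel_has_integral[OF \<alpha> t]];
        use rl_kernel_nonneg[OF \<alpha>] in simp)+
  show ?thesis
  proof (cases "1 \<le> \<alpha>")
    case True
    have "rl_kernel \<alpha> t s \<le> rl_kernel \<alpha> \<tau> s" for s
      using True \<alpha> t Gamma_real_pos[OF \<alpha>]
      by (auto simp: rl_kernel_def intro!: divide_right_mono powr_mono2)
    then have "(LINT s|?M. \<bar>rl_kernel \<alpha> \<tau> s - rl_kernel \<alpha> t s\<bar>) = (LINT s|?M. rl_kernel \<alpha> \<tau> s - rl_kernel \<alpha> t s)"
      by simp
    also have "\<dots> = ((\<tau> - a) powr \<alpha> - (t - a) powr \<alpha>) / (\<alpha> * Gamma \<alpha>)"
      using i v by (simp add: diff_divide_distrib)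
    also have "\<dots> \<le> (\<bar>(\<tau> - a) powr \<alpha> - (t - a) powr \<alpha>\<bar> + 2 * (\<tau> - t) powr \<alpha>) / (\<alpha> * Gamma \<alpha>)"
      using pos abs_ge_self[of "(\<tau> - a) powr \<alpha> - (t - a) powr \<alpha>"] powr_ge_zero[of "\<tau> - t" \<alpha>]
      by (intro divide_right_mono) linarith+
    finally show ?thesis .
  next
    case False
    have le: "\<bar>rl_kernel \<alpha> \<tau> s - rl_kernel \<alpha> t s\<bar> \<le> rl_kernel \<alpha> t s - rl_kernel \<alpha> \<tau> s + 2 * ?g s" for s
    proof (cases "s < t")
      case True
      then have "rl_kernel \<alpha> \<tau> s \<le> rl_kernel \<alpha> t s"
        using False \<alpha> t Gamma_real_pos[OF \<alpha>]
        by (auto simp: rl_kernel_def intro!: divide_right_mono powr_mono2')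
      then show ?thesis using True by simp
    next
      case False
      then have "rl_kernel \<alpha> t s = 0" "?g s = rl_kernel \<alpha> \<tau> s"
        by (auto simp: rl_kernel_def)
      then show ?thesis
        using rl_kernel_nonneg[OF \<alpha>, of \<tau> s] by simp
    qed
    have "(LINT s|?M. \<bar>rl_kernel \<alpha> \<tau> s - rl_kernel \<alpha> t s\<bar>) \<le> (LINT s|?M. rl_kernel \<alpha> t s - rl_kernel \<alpha> \<tau> s + 2 * ?g s)"
      using i g(1) le by (intro integral_mono) (auto simp del: if_split)
    also have "\<dots> = ((t - a) powr \<alpha> - (\<tau> - a) powr \<alpha> + 2 * (\<tau> - t) powr \<alpha>) / (\<alpha> * Gamma \<alpha>)"
      using i v g by (simp add: diff_divide_distrib add_divide_distrib)
    also have "\<dots> \<le> (\<bar>(\<tau> - a) powr \<alpha> - (t - a) powr \<alpha>\<bar> + 2 * (\<tau> - t) powr \<alpha>) / (\<alpha> * Gamma \<alpha>)"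
      using pos by (intro divide_right_mono) auto
    finally show ?thesis .
  qed
qed

lemma rl_kernel_L1_equicontinuous:
  fixes a b \<alpha> \<epsilon> :: real
  assumes \<alpha>: "0 < \<alpha>" and \<epsilon>: "0 < \<epsilon>"
  obtains \<delta> where "0 < \<delta>" "\<And>t \<tau>. t \<in> {a..b} \<Longrightarrow> \<tau> \<in> {a..b} \<Longrightarrow> \<bar>\<tau> - t\<bar> < \<delta> \<Longrightarrow>
    (LINT s|lebesgue_on {a..b}. \<bar>rl_kernel \<alpha> \<tau> s - rl_kernel \<alpha> t s\<bar>) < \<epsilon>"
proof -
  let ?C = "\<alpha> * Gamma \<alpha>"
  have C: "0 < ?C"
    using \<alpha> by (simp add: Gamma_real_pos)
  have "uniformly_continuous_on {0..b - a} (\<lambda>x. x powr \<alpha>)"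
    using \<alpha> by (intro compact_uniformly_continuous continuous_on_powr' continuous_intros) auto
  then obtain \<delta> where \<delta>: "0 < \<delta>"
    "\<And>x y. x \<in> {0..b - a} \<Longrightarrow> y \<in> {0..b - a} \<Longrightarrow> \<bar>x - y\<bar> < \<delta> \<Longrightarrow> \<bar>x powr \<alpha> - y powr \<alpha>\<bar> < \<epsilon> * ?C / 3"
    using \<epsilon> C unfolding uniformly_continuous_on_def dist_real_def
    by (metis abs_minus_commute divide_pos_pos mult_pos_pos zero_less_numeral)
  have ordered: "(LINT s|lebesgue_on {a..b}. \<bar>rl_kernel \<alpha> \<tau> s - rl_kernel \<alpha> t s\<bar>) < \<epsilon>"
    if "a \<le> t" "t \<le> \<tau>" "\<tau> \<le> b" "\<tau> - t < \<delta>" for t \<tau>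
  proof -
    have "\<bar>(\<tau> - a) powr \<alpha> - (t - a) powr \<alpha>\<bar> < \<epsilon> * ?C / 3"
      using that by (intro \<delta>) auto
    moreover have "(\<tau> - t) powr \<alpha> < \<epsilon> * ?C / 3"
      using \<delta>(2)[of "\<tau> - t" 0] that \<alpha> by auto
    ultimately have "(\<bar>(\<tau> - a) powr \<alpha> - (t - a) powr \<alpha>\<bar> + 2 * (\<tau> - t) powr \<alpha>) / ?C < \<epsilon>"
      using C by (simp add: divide_less_eq)
    with rl_kernel_L1_dist_le[OF \<alpha> that(1-3)] show ?thesis
      by linarith
  qed
  show thesis
  proof (rule that[OF \<delta>(1)])
    fix t \<tau> assume t: "t \<in> {a..b}" "\<tau> \<in> {a..b}" "\<bar>\<tau> - t\<bar> < \<delta>"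
    show "(LINT s|lebesgue_on {a..b}. \<bar>rl_kernel \<alpha> \<tau> s - rl_kernel \<alpha> t s\<bar>) < \<epsilon>"
      using ordered[of t \<tau>] ordered[of \<tau> t] t by (cases "t \<le> \<tau>") (auto simp: abs_minus_commute)
  qed
qed

text \<open>
  The kernel of order \<open>1 + \<alpha>\<close> is a primitive in \<open>t\<close> of the kernel of order \<open>\<alpha>\<close>, so for \<open>s\<close> below both
  times the mean value theorem gives the remainder as \<open>\<tau> - t\<close> times a difference of kernels at an
  intermediate time, and monotonicity in time bounds it by the difference at the end points. If \<open>s\<close> lies
  between the times, one of the kernels vanishes and the relation \<open>k\<^bsub>1 + \<alpha>\<^esub> = (t - s) k\<^bsub>\<alpha>\<^esub> / \<alpha>\<close> gives the bound;
  this is where \<open>1 / \<alpha>\<close> enters. Since the right-hand side has small \<open>L\<^sup>1\<close> norm for \<open>\<tau>\<close> near \<open>t\<close>, differentiation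
  under the integral is legitimate although the kernel may be singular.
\<close>

lemma rl_kernel_first_order:
  assumes \<alpha>: "0 < \<alpha>"
  shows "\<bar>rl_kernel (1 + \<alpha>) \<tau> s - rl_kernel (1 + \<alpha>) t s - (\<tau> - t) * rl_kernel \<alpha> t s\<bar>
    \<le> \<bar>\<tau> - t\<bar> * (1 + 1 / \<alpha>) * \<bar>rl_kernel \<alpha> \<tau> s - rl_kernel \<alpha> t s\<bar>"
proof -
  let ?k = "rl_kernel \<alpha>"
  have G: "0 < Gamma \<alpha>" "Gamma (1 + \<alpha>) = \<alpha> * Gamma \<alpha>"
    using \<alpha> Gamma_plus1[of \<alpha>] nonpos_Ints_nonpos[of \<alpha>] by (auto simp: Gamma_real_pos add.commute)
  have k: "0 \<le> ?k x s" for x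
    by (rule rl_kernel_nonneg[OF \<alpha>])
  have prim: "rl_kernel (1 + \<alpha>) x s = (x - s) / \<alpha> * ?k x s" for x
  proof (cases "s < x")
    case True
    then have "(x - s) * (x - s) powr (\<alpha> - 1) = (x - s) powr \<alpha>"
      using powr_mult_base[of "x - s" "\<alpha> - 1"] by simp
    with True G(2) show ?thesis
      by (simp add: rl_kernel_def mult.commute)
  qed (simp add: rl_kernel_def)
  have mvt: ?thesis if s: "s < \<tau>" "s < t"
  proof -
    define p where "p x = (x - s) powr \<alpha> / (\<alpha> * Gamma \<alpha>)" for x
    have p: "rl_kernel (1 + \<alpha>) x s = p x" if "s < x" for x
      using that G by (simp add: rl_kernel_def p_def)
    have deriv: "(p has_real_derivative ?k x s) (at x)" if "s < x" for x
    proof -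
      have "((\<lambda>x. (x - s) powr \<alpha>) has_real_derivative \<alpha> * (x - s) powr (\<alpha> - 1)) (at x)"
        using that by (auto intro!: derivative_eq_intros)
      from DERIV_cdivide[OF this, of "\<alpha> * Gamma \<alpha>"] show ?thesis
        using that \<alpha> by (simp add: p_def[abs_def] rl_kernel_def)
    qed
    have mono: "(\<forall>x y. s < x \<longrightarrow> x \<le> y \<longrightarrow> ?k x s \<le> ?k y s) \<or> (\<forall>x y. s < x \<longrightarrow> x \<le> y \<longrightarrow> ?k y s \<le> ?k x s)"
    proof (cases "1 \<le> \<alpha>")
      case True
      then have "?k x s \<le> ?k y s" if "s < x" "x \<le> y" for x y
        using that G(1) by (auto simp: rl_kernel_def intro!: divide_right_mono powr_mono2)
      then show ?thesis by blast
    next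
      case False
      then have "?k y s \<le> ?k x s" if "s < x" "x \<le> y" for x y
        using that G(1) by (auto simp: rl_kernel_def intro!: divide_right_mono powr_mono2')
      then show ?thesis by blast
    qed
    have "\<exists>\<xi>. s < \<xi> \<and> p \<tau> - p t = (\<tau> - t) * ?k \<xi> s \<and> (t \<le> \<xi> \<and> \<xi> \<le> \<tau> \<or> \<tau> \<le> \<xi> \<and> \<xi> \<le> t)"
    proof (cases t \<tau> rule: linorder_cases)
      case less
      then obtain z where "z > t" "z < \<tau>" "p \<tau> - p t = (\<tau> - t) * ?k z s"
        using MVT2[of t \<tau> p "\<lambda>x. ?k x s"] deriv s by force
      then show ?thesis using s by (intro exI[of _ z]) auto
    next
      case equal
      then show ?thesis using s by auto
    next
      case greater
      then obtain z where "z > \<tau>" "z < t" "p t - p \<tau> = (t - \<tau>) * ?k z s"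
        using MVT2[of \<tau> t p "\<lambda>x. ?k x s"] deriv s by force
      then show ?thesis using s by (intro exI[of _ z]) (auto simp: algebra_simps)
    qed
    then obtain \<xi> where \<xi>: "s < \<xi>" "p \<tau> - p t = (\<tau> - t) * ?k \<xi> s" "t \<le> \<xi> \<and> \<xi> \<le> \<tau> \<or> \<tau> \<le> \<xi> \<and> \<xi> \<le> t"
      by blast
    have "\<bar>?k \<xi> s - ?k t s\<bar> \<le> \<bar>?k \<tau> s - ?k t s\<bar>"
      using mono
    proof
      assume m: "\<forall>x y. s < x \<longrightarrow> x \<le> y \<longrightarrow> ?k x s \<le> ?k y s"
      show ?thesis
        using \<xi>(3) m[rule_format, of t \<xi>] m[rule_format, of \<xi> \<tau>] m[rule_format, of \<tau> \<xi>] m[rule_format, of \<xi> t] s \<xi>(1)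
        by auto
    next
      assume m: "\<forall>x y. s < x \<longrightarrow> x \<le> y \<longrightarrow> ?k y s \<le> ?k x s"
      show ?thesis
        using \<xi>(3) m[rule_format, of t \<xi>] m[rule_format, of \<xi> \<tau>] m[rule_format, of \<tau> \<xi>] m[rule_format, of \<xi> t] s \<xi>(1)
        by auto
    qed
    also have "\<dots> \<le> (1 + 1 / \<alpha>) * \<bar>?k \<tau> s - ?k t s\<bar>"
      using \<alpha> by (simp add: field_simps)
    finally have "\<bar>\<tau> - t\<bar> * \<bar>?k \<xi> s - ?k t s\<bar> \<le> \<bar>\<tau> - t\<bar> * ((1 + 1 / \<alpha>) * \<bar>?k \<tau> s - ?k t s\<bar>)"
      by (rule mult_left_mono) simp
    moreover have "rl_kernel (1 + \<alpha>) \<tau> s - rl_kernel (1 + \<alpha>) t s - (\<tau> - t) * ?k t s = (\<tau> - t) * (?k \<xi> s - ?k t s)"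
      using p s \<xi>(2) by (simp add: algebra_simps)
    ultimately show ?thesis
      by (simp add: abs_mult mult.assoc)
  qed
  consider "s < \<tau>" "s < t" | "s < \<tau>" "t \<le> s" | "\<tau> \<le> s" "s < t" | "\<tau> \<le> s" "t \<le> s"
    by linarith
  then show ?thesis
  proof cases
    case 2
    then have "?k t s = 0" by (simp add: rl_kernel_def)
    moreover have "(\<tau> - s) / \<alpha> * ?k \<tau> s \<le> (\<tau> - t) * (1 + 1 / \<alpha>) * ?k \<tau> s"
    proof (intro mult_right_mono k)
      have "(\<tau> - s) / \<alpha> \<le> (\<tau> - t) / \<alpha>"
        using 2 \<alpha> by (intro divide_right_mono) auto
      then show "(\<tau> - s) / \<alpha> \<le> (\<tau> - t) * (1 + 1 / \<alpha>)"
        using 2 by (simp add: distrib_left)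
    qed
    ultimately show ?thesis
      using 2 \<alpha> k[of \<tau>] by (simp add: prim abs_mult)
  next
    case 3
    then have "?k \<tau> s = 0" by (simp add: rl_kernel_def)
    moreover have "\<bar>(t - \<tau>) - (t - s) / \<alpha>\<bar> * ?k t s \<le> (t - \<tau>) * (1 + 1 / \<alpha>) * ?k t s"
    proof (intro mult_right_mono k)
      have "(t - s) / \<alpha> \<le> (t - \<tau>) / \<alpha>" "0 \<le> (t - s) / \<alpha>"
        using 3 \<alpha> by (auto intro: divide_right_mono)
      then show "\<bar>(t - \<tau>) - (t - s) / \<alpha>\<bar> \<le> (t - \<tau>) * (1 + 1 / \<alpha>)"
        using 3 by (simp add: distrib_left)
    qed
    moreover have "\<bar>- ((t - s) / \<alpha> * ?k t s) - (\<tau> - t) * ?k t s\<bar> = \<bar>(t - \<tau>) - (t - s) / \<alpha>\<bar> * ?k t s"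
      using k[of t] by (simp add: abs_mult_pos' left_diff_distrib abs_minus_commute algebra_simps)
    ultimately show ?thesis
      using 3 k[of t] by (simp add: prim)
  qed (use mvt in \<open>auto simp: rl_kernel_def\<close>)
qed

section \<open>Equicontinuity and differentiability of fractional integrals\<close>

lemma rl_integral_eq_kernel:
  fixes f :: "real \<Rightarrow> 'x::banach"
  assumes \<beta>: "0 < \<beta>" and t: "a \<le> t" "t \<le> b"
    and f: "bochner_measurable (lebesgue_on {a..b}) f" "AE s in lebesgue_on {a..b}. norm (f s) \<le> c" "0 \<le> c"
  shows "rl_integral a \<beta> f t = bochner_integral (lebesgue_on {a..b}) (\<lambda>s. rl_kernel \<beta> t s *\<^sub>R f s)" (is "_ = ?v")
proof -
  have G: "0 < Gamma \<beta>"
    using \<beta> by (rule Gamma_real_pos)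
  have "has_bochner_value (lebesgue_on {a..b}) (\<lambda>s. rl_kernel \<beta> t s *\<^sub>R f s) ?v"
    by (rule has_bochner_value_kernel[OF refl f integrable_rl_kernel[OF \<beta> t]])
  then have "has_bochner_value (lebesgue_on {a..t}) (\<lambda>s. rl_kernel \<beta> t s *\<^sub>R f s) ?v"
    using t by (elim has_bochner_value_subinterval) (auto simp: rl_kernel_def)
  then have "bochner_integral (lebesgue_on {a..t}) (\<lambda>s. Gamma \<beta> *\<^sub>R rl_kernel \<beta> t s *\<^sub>R f s) = Gamma \<beta> *\<^sub>R ?v"
    by (intro bochner_integral_eqI[OF refl] has_bochner_value_scaleR[OF refl])
  moreover have "bochner_integral (lebesgue_on {a..t}) (\<lambda>s. (t - s) powr (\<beta> - 1) *\<^sub>R f s)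
      = bochner_integral (lebesgue_on {a..t}) (\<lambda>s. Gamma \<beta> *\<^sub>R rl_kernel \<beta> t s *\<^sub>R f s)"
    using G by (intro bochner_integral_cong_AE AE_I2) (auto simp: rl_kernel_def)
  ultimately show ?thesis
    using G by (simp add: rl_integral_def)
qed

text \<open>
  The \<open>\<delta>\<close> is chosen before \<open>f\<close>: on the functions bounded by \<open>c\<close>, the integrals of order \<open>\<alpha>\<close> are
  equicontinuous, and those of order \<open>1 + \<alpha>\<close> are differentiable with derivative of order \<open>\<alpha>\<close> at a common
  rate. Both reduce to the \<open>L\<^sup>1\<close> continuity of the kernel.
\<close>

lemma rl_integral_equicontinuous_derivative:
  fixes a b \<alpha> c \<epsilon> :: real
  assumes \<alpha>: "0 < \<alpha>" and c: "0 \<le> c" and \<epsilon>: "0 < \<epsilon>"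
  obtains \<delta> where "0 < \<delta>"
    "\<And>(f :: real \<Rightarrow> 'x::banach) t \<tau>. bochner_measurable (lebesgue_on {a..b}) f \<Longrightarrow>
      AE s in lebesgue_on {a..b}. norm (f s) \<le> c \<Longrightarrow> t \<in> {a..b} \<Longrightarrow> \<tau> \<in> {a..b} \<Longrightarrow> \<bar>\<tau> - t\<bar> < \<delta> \<Longrightarrow>
      norm (rl_integral a \<alpha> f \<tau> - rl_integral a \<alpha> f t) \<le> \<epsilon> \<and>
      norm (rl_integral a (1 + \<alpha>) f \<tau> - rl_integral a (1 + \<alpha>) f t - (\<tau> - t) *\<^sub>R rl_integral a \<alpha> f t) \<le> \<epsilon> * \<bar>\<tau> - t\<bar>"
proof -
  let ?M = "lebesgue_on {a..b}"
  define C where "C = 1 + 1 / \<alpha>"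
  have C: "1 \<le> C"
    using \<alpha> by (simp add: C_def)
  \<comment> \<open>\<open>c + 1\<close> instead of \<open>c\<close> because \<open>c\<close> may be zero\<close>
  define \<eta> where "\<eta> = \<epsilon> / ((c + 1) * C)"
  have \<eta>: "0 < \<eta>"
    using \<epsilon> c C by (simp add: \<eta>_def)
  have c\<eta>: "c * (C * \<eta>) \<le> \<epsilon>" "c * \<eta> \<le> \<epsilon>"
  proof -
    have "c * (C * \<eta>) = \<epsilon> * (c / (c + 1))"
      using C c by (simp add: \<eta>_def)
    also have "\<dots> \<le> \<epsilon> * 1"
      using c \<epsilon> by (intro mult_left_mono) auto
    finally show 1: "c * (C * \<eta>) \<le> \<epsilon>" by simp
    have "c * \<eta> \<le> c * (C * \<eta>)"
      using C c \<eta> by (intro mult_left_mono) auto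
    with 1 show "c * \<eta> \<le> \<epsilon>" by simp
  qed
  obtain \<delta> where \<delta>: "0 < \<delta>" "\<And>t \<tau>. t \<in> {a..b} \<Longrightarrow> \<tau> \<in> {a..b} \<Longrightarrow> \<bar>\<tau> - t\<bar> < \<delta> \<Longrightarrow>
    (LINT s|?M. \<bar>rl_kernel \<alpha> \<tau> s - rl_kernel \<alpha> t s\<bar>) < \<eta>"
    using rl_kernel_L1_equicontinuous[OF \<alpha> \<eta>] by metis
  show thesis
  proof (rule that[OF \<delta>(1)])
    fix f :: "real \<Rightarrow> 'x" and t \<tau>
    assume f: "bochner_measurable ?M f" "AE s in ?M. norm (f s) \<le> c"
      and t: "t \<in> {a..b}" "\<tau> \<in> {a..b}" "\<bar>\<tau> - t\<bar> < \<delta>"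
    let ?I = "LINT s|?M. \<bar>rl_kernel \<alpha> \<tau> s - rl_kernel \<alpha> t s\<bar>"
    have int: "integrable ?M (rl_kernel \<beta> x)" if "0 < \<beta>" "x \<in> {a..b}" for \<beta> x
      using that by (intro integrable_rl_kernel) auto
    note I = \<delta>(2)[OF t]
    have rep: "rl_integral a \<beta> f x = bochner_integral ?M (\<lambda>s. rl_kernel \<beta> x s *\<^sub>R f s)" if "0 < \<beta>" "x \<in> {a..b}" for \<beta> x
      using that by (intro rl_integral_eq_kernel[OF _ _ _ f c]) auto
    note le = norm_bochner_integral_kernel_le[OF refl f c]
    have "norm (rl_integral a \<alpha> f \<tau> - rl_integral a \<alpha> f t) \<le> c * ?I"
      using le[OF int[OF \<alpha> t(2)] int[OF \<alpha> t(1)] int[OF \<alpha> t(1)], of 0]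
      unfolding rep[OF \<alpha> t(1)] rep[OF \<alpha> t(2)] by simp
    also have "\<dots> \<le> c * \<eta>"
      using I c by (intro mult_left_mono) auto
    also note c\<eta>(2)
    finally have 1: "norm (rl_integral a \<alpha> f \<tau> - rl_integral a \<alpha> f t) \<le> \<epsilon>" .
    have \<alpha>1: "0 < 1 + \<alpha>" using \<alpha> by simp
    let ?e = "\<lambda>s. rl_kernel (1 + \<alpha>) \<tau> s - rl_kernel (1 + \<alpha>) t s - (\<tau> - t) * rl_kernel \<alpha> t s"
    have "norm (rl_integral a (1 + \<alpha>) f \<tau> - rl_integral a (1 + \<alpha>) f t - (\<tau> - t) *\<^sub>R rl_integral a \<alpha> f t)
        \<le> c * (LINT s|?M. \<bar>?e s\<bar>)"
      using le[OF int[OF \<alpha>1 t(2)] int[OF \<alpha>1 t(1)] int[OF \<alpha> t(1)], of "\<tau> - t"]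
      unfolding rep[OF \<alpha> t(1)] rep[OF \<alpha>1 t(1)] rep[OF \<alpha>1 t(2)] .
    also have "(LINT s|?M. \<bar>?e s\<bar>) \<le> (LINT s|?M. \<bar>\<tau> - t\<bar> * C * \<bar>rl_kernel \<alpha> \<tau> s - rl_kernel \<alpha> t s\<bar>)"
    proof (rule integral_mono)
      show "integrable ?M (\<lambda>s. \<bar>?e s\<bar>)"
        using int[OF \<alpha>1 t(2)] int[OF \<alpha>1 t(1)] int[OF \<alpha> t(1)] by simp
      show "integrable ?M (\<lambda>s. \<bar>\<tau> - t\<bar> * C * \<bar>rl_kernel \<alpha> \<tau> s - rl_kernel \<alpha> t s\<bar>)"
        using int[OF \<alpha> t(2)] int[OF \<alpha> t(1)] by simp
    qed (use rl_kernel_first_order[OF \<alpha>] in \<open>simp add: C_def\<close>)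
    also have "\<dots> = \<bar>\<tau> - t\<bar> * C * ?I"
      by simp
    also have "c * (\<bar>\<tau> - t\<bar> * C * ?I) \<le> c * (\<bar>\<tau> - t\<bar> * C * \<eta>)"
      using I c C by (intro mult_left_mono mult_nonneg_nonneg) auto
    also have "\<dots> = c * (C * \<eta>) * \<bar>\<tau> - t\<bar>"
      by simp
    also have "\<dots> \<le> \<epsilon> * \<bar>\<tau> - t\<bar>"
      using c\<eta>(1) by (intro mult_right_mono) auto
    finally show "norm (rl_integral a \<alpha> f \<tau> - rl_integral a \<alpha> f t) \<le> \<epsilon> \<and>
      norm (rl_integral a (1 + \<alpha>) f \<tau> - rl_integral a (1 + \<alpha>) f t - (\<tau> - t) *\<^sub>R rl_integral a \<alpha> f t) \<le> \<epsilon> * \<bar>\<tau> - t\<bar>"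
      using 1 c by (simp add: mult_left_mono)
  qed
qed

lemma
  fixes f :: "real \<Rightarrow> 'x::banach"
  assumes \<alpha>: "0 < \<alpha>" and c: "0 \<le> c"
    and f: "bochner_measurable (lebesgue_on {a..b}) f" "AE s in lebesgue_on {a..b}. norm (f s) \<le> c"
  shows continuous_on_rl_integral: "continuous_on {a..b} (rl_integral a \<alpha> f)"
    and rl_integral_has_vector_derivative: "t \<in> {a..b} \<Longrightarrow>
      (rl_integral a (1 + \<alpha>) f has_vector_derivative rl_integral a \<alpha> f t) (at t within {a..b})"
proof -
  show "continuous_on {a..b} (rl_integral a \<alpha> f)"
    unfolding continuous_on_iff
  proof (intro ballI allI impI)
    fix t \<epsilon> :: real assume t: "t \<in> {a..b}" and "0 < \<epsilon>"
    then have "0 < \<epsilon> / 2" by simp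
    from rl_integral_equicontinuous_derivative[OF \<alpha> c this] obtain \<delta> where "0 < \<delta>"
      "\<And>\<tau>. \<tau> \<in> {a..b} \<Longrightarrow> \<bar>\<tau> - t\<bar> < \<delta> \<Longrightarrow> norm (rl_integral a \<alpha> f \<tau> - rl_integral a \<alpha> f t) \<le> \<epsilon> / 2"
      using f t by metis
    with \<open>0 < \<epsilon>\<close> show "\<exists>\<delta>>0. \<forall>\<tau>\<in>{a..b}. dist \<tau> t < \<delta> \<longrightarrow> dist (rl_integral a \<alpha> f \<tau>) (rl_integral a \<alpha> f t) < \<epsilon>"
      by (intro exI[of _ \<delta>]) (force simp: dist_norm)
  qed
  assume t: "t \<in> {a..b}"
  have "\<exists>\<delta>>0. \<forall>\<tau>\<in>{a..b}. norm (\<tau> - t) < \<delta> \<longrightarrow>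
      norm (rl_integral a (1 + \<alpha>) f \<tau> - rl_integral a (1 + \<alpha>) f t - (\<tau> - t) *\<^sub>R rl_integral a \<alpha> f t) \<le> \<epsilon> * norm (\<tau> - t)"
    if "0 < \<epsilon>" for \<epsilon>
    using rl_integral_equicontinuous_derivative[OF \<alpha> c that] f t real_norm_def by metis
  then show "(rl_integral a (1 + \<alpha>) f has_vector_derivative rl_integral a \<alpha> f t) (at t within {a..b})"
    unfolding has_vector_derivative_def has_derivative_within_alt
    by (simp add: bounded_linear_scaleR_left)
qed

section \<open>Total boundedness\<close>

lemma compact_closure_if_totally_bounded:
  fixes S :: "'a::complete_space set"
  assumes "\<And>e. 0 < e \<Longrightarrow> \<exists>K. finite K \<and> S \<subseteq> (\<Union>x\<in>K. ball x e)"
  shows "compact (closure S)"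
  unfolding compact_eq_totally_bounded
proof (intro conjI allI impI)
  show "complete (closure S)"
    by (simp add: complete_eq_closed)
  fix e :: real assume "0 < e"
  then obtain K where K: "finite K" "S \<subseteq> (\<Union>x\<in>K. ball x (e / 2))"
    using assms[of "e / 2"] by auto
  have "closure S \<subseteq> (\<Union>x\<in>K. cball x (e / 2))"
    using K by (intro closure_minimal) (auto simp: less_imp_le subset_iff, blast intro: less_imp_le)
  also have "\<dots> \<subseteq> (\<Union>x\<in>K. ball x e)"
    using \<open>0 < e\<close> by (intro UN_mono) auto
  finally show "\<exists>k. finite k \<and> closure S \<subseteq> (\<Union>x\<in>k. ball x e)"
    using K(1) by blast
qed

text \<open>
  Choosing one representative for each label turns a finite labelling into a finite net consisting of
  members of the set itself.
\<close>

lemma finite_net_from_labels: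
  assumes fin: "finite (L ` I)" and same: "\<And>f g. f \<in> I \<Longrightarrow> g \<in> I \<Longrightarrow> L f = L g \<Longrightarrow> P f g"
  obtains K where "finite K" "K \<subseteq> I" "\<And>f. f \<in> I \<Longrightarrow> \<exists>g\<in>K. P f g"
proof
  let ?r = "inv_into I L"
  show "finite (?r ` L ` I)" "?r ` L ` I \<subseteq> I"
    using fin by (auto intro: inv_into_into)
  show "\<exists>g\<in>?r ` L ` I. P f g" if "f \<in> I" for f
    using same[OF that inv_into_into[of "L f" L I]] that by (auto simp: f_inv_into_f)
qed

text \<open>
  An Arzela-Ascoli argument in which \<open>w\<close> stands for the primitive of \<open>u\<close>. Each grid point \<open>d\<close> comes with a
  slightly later point \<open>q d\<close>, and the label of \<open>f\<close> records near which centre of a finite net the increment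
  of \<open>w f\<close> over \<open>{d..q d}\<close> lies. Equal labels force the difference quotients, hence the values of \<open>u\<close> at the
  grid points, to be close, and equicontinuity carries this to all times.
\<close>

lemma finite_uniform_net_if_increments_compact:
  fixes u w :: "'i \<Rightarrow> real \<Rightarrow> 'x::real_normed_vector"
  assumes ab: "a < b"
    and equi: "\<And>\<epsilon>. 0 < \<epsilon> \<Longrightarrow> \<exists>\<delta>>0. \<forall>f\<in>I. \<forall>t\<in>{a..b}. \<forall>\<tau>\<in>{a..b}. \<bar>\<tau> - t\<bar> < \<delta> \<longrightarrow>
      norm (u f \<tau> - u f t) \<le> \<epsilon> \<and> norm (w f \<tau> - w f t - (\<tau> - t) *\<^sub>R u f t) \<le> \<epsilon> * \<bar>\<tau> - t\<bar>"
    and comp: "\<And>p q. a < p \<Longrightarrow> p < q \<Longrightarrow> q < b \<Longrightarrow> compact (closure {w f q - w f p | f. f \<in> I})"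
    and e: "0 < e"
  obtains K where "finite K" "K \<subseteq> I" "\<And>f. f \<in> I \<Longrightarrow> \<exists>g\<in>K. \<forall>t\<in>{a..b}. norm (u f t - u g t) \<le> e"
proof -
  \<comment> \<open>on equal labels the values differ by at most \<open>4 * \<eta>\<close> at a grid point and \<open>6 * \<eta>\<close> elsewhere\<close>
  define \<eta> where "\<eta> = e / 8"
  have \<eta>: "0 < \<eta>" using e by (simp add: \<eta>_def)
  obtain \<delta> where \<delta>: "0 < \<delta>" "\<And>f t \<tau>. f \<in> I \<Longrightarrow> t \<in> {a..b} \<Longrightarrow> \<tau> \<in> {a..b} \<Longrightarrow> \<bar>\<tau> - t\<bar> < \<delta> \<Longrightarrow>
      norm (u f \<tau> - u f t) \<le> \<eta> \<and> norm (w f \<tau> - w f t - (\<tau> - t) *\<^sub>R u f t) \<le> \<eta> * \<bar>\<tau> - t\<bar>"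
    using equi[OF \<eta>] by blast
  have "{a..b} \<subseteq> (\<Union>d\<in>{a<..<b}. ball d \<delta>)"
  proof
    fix t assume "t \<in> {a..b}"
    then have "t \<in> closure {a<..<b}"
      using ab by simp
    then obtain d where "d \<in> {a<..<b}" "dist d t < \<delta>"
      using \<delta>(1) unfolding closure_approachable by blast
    then show "t \<in> (\<Union>d\<in>{a<..<b}. ball d \<delta>)"
      by (intro UN_I) (simp_all only: mem_ball)
  qed
  then obtain D where D: "D \<subseteq> {a<..<b}" "finite D" "{a..b} \<subseteq> (\<Union>d\<in>D. ball d \<delta>)"
    by (rule compactE_image[OF compact_Icc open_ball])
  \<comment> \<open>increments are controlled only inside the open interval, hence the midpoint below \<open>b\<close>\<close>
  define q where "q d = (d + min b (d + \<delta>)) / 2" for d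
  have q: "d < q d" "q d < b" "q d - d < \<delta>" if "d \<in> D" for d
    using that D(1) \<delta>(1) by (auto simp: q_def min_def)
  have "\<exists>C. finite C \<and> {w f (q d) - w f d | f. f \<in> I} \<subseteq> (\<Union>x\<in>C. ball x (\<eta> * (q d - d)))" if "d \<in> D" for d
  proof -
    have "compact (closure {w f (q d) - w f d | f. f \<in> I})"
      using that D(1) q by (intro comp) auto
    moreover have "0 < \<eta> * (q d - d)"
      using \<eta> q that by simp
    ultimately show ?thesis
      unfolding compact_eq_totally_bounded using closure_subset by (meson order_trans)
  qed
  then have "\<exists>C. \<forall>d\<in>D. finite (C d) \<and> {w f (q d) - w f d | f. f \<in> I} \<subseteq> (\<Union>x\<in>C d. ball x (\<eta> * (q d - d)))"
    by (intro bchoice ballI)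
  then obtain C where C0: "\<forall>d\<in>D. finite (C d) \<and> {w f (q d) - w f d | f. f \<in> I} \<subseteq> (\<Union>x\<in>C d. ball x (\<eta> * (q d - d)))"
    by (rule exE)
  have C: "finite (C d)" "f \<in> I \<Longrightarrow> \<exists>x\<in>C d. dist x (w f (q d) - w f d) < \<eta> * (q d - d)" if "d \<in> D" for d f
  proof -
    show "finite (C d)"
      by (rule conjunct1[OF bspec[OF C0 that]])
    assume "f \<in> I"
    then have "w f (q d) - w f d \<in> {w f (q d) - w f d | f. f \<in> I}"
      by auto
    from subsetD[OF conjunct2[OF bspec[OF C0 that]] this]
    show "\<exists>x\<in>C d. dist x (w f (q d) - w f d) < \<eta> * (q d - d)"
      by simp
  qed
  define L where "L f = (\<lambda>d\<in>D. SOME x. x \<in> C d \<and> dist x (w f (q d) - w f d) < \<eta> * (q d - d))" for f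
  have L: "L f d \<in> C d \<and> dist (L f d) (w f (q d) - w f d) < \<eta> * (q d - d)" if "f \<in> I" "d \<in> D" for f d
    unfolding L_def using someI_ex[OF C(2)[OF that(2,1), unfolded Bex_def]]
    by (simp only: restrict_apply that(2) if_True)
  have "L f \<in> PiE D C" if "f \<in> I" for f
    using L[OF that] by (intro PiE_I) (simp_all add: L_def)
  then have "L ` I \<subseteq> PiE D C"
    by (rule image_subsetI)
  then have fin: "finite (L ` I)"
    by (rule finite_subset) (intro finite_PiE D(2) C(1))
  have same: "\<forall>t\<in>{a..b}. norm (u f t - u g t) \<le> e" if fg: "f \<in> I" "g \<in> I" "L f = L g" for f g
  proof
    fix t assume t: "t \<in> {a..b}"
    then obtain d where d: "d \<in> D" "\<bar>t - d\<bar> < \<delta>"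
      using D(3) by (auto simp: dist_real_def abs_minus_commute)
    then have dq: "d \<in> {a..b}" "q d \<in> {a..b}" "\<bar>q d - d\<bar> < \<delta>" and h: "0 < q d - d"
      using D(1) q[of d] by auto
    let ?h = "q d - d"
    have "norm (?h *\<^sub>R (u f d - u g d)) \<le> 4 * \<eta> * ?h"
    proof -
      define x where "x = L f d"
      have 1: "norm (w f (q d) - w f d - ?h *\<^sub>R u f d) \<le> \<eta> * ?h" "norm (w g (q d) - w g d - ?h *\<^sub>R u g d) \<le> \<eta> * ?h"
        using \<delta>(2)[OF fg(1) dq] \<delta>(2)[OF fg(2) dq] h by simp_all
      have 2: "norm (x - (w f (q d) - w f d)) < \<eta> * ?h" "norm (x - (w g (q d) - w g d)) < \<eta> * ?h"
        using L[of f d] L[of g d] fg d(1) by (auto simp: x_def dist_norm)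
      have eq: "?h *\<^sub>R (u f d - u g d) = ((w g (q d) - w g d - ?h *\<^sub>R u g d) - (w f (q d) - w f d - ?h *\<^sub>R u f d))
          + ((x - (w g (q d) - w g d)) - (x - (w f (q d) - w f d)))"
        by (simp add: algebra_simps)
      have "norm (?h *\<^sub>R (u f d - u g d)) \<le> (\<eta> * ?h + \<eta> * ?h) + (\<eta> * ?h + \<eta> * ?h)"
        unfolding eq
        by (rule order_trans[OF norm_triangle_ineq add_mono[OF order_trans[OF norm_triangle_ineq4 add_mono]
              order_trans[OF norm_triangle_ineq4 add_mono]]])
          (rule 1 less_imp_le[OF 2(1)] less_imp_le[OF 2(2)])+
      then show ?thesis by (simp only:)
    qed
    then have n1: "norm (u f d - u g d) \<le> 4 * \<eta>"
      using h by (simp add: mult.commute)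
    have n2: "norm (u f t - u f d) \<le> \<eta>" "norm (u g t - u g d) \<le> \<eta>"
      using \<delta>(2)[OF _ dq(1) t d(2)] fg by auto
    have bound: "norm ((u f t - u f d) + (u f d - u g d) - (u g t - u g d)) \<le> \<eta> + 4 * \<eta> + \<eta>"
      by (rule order_trans[OF norm_triangle_ineq4 add_mono[OF order_trans[OF norm_triangle_ineq add_mono]]])
        (rule n1 n2)+
    have "(u f t - u f d) + (u f d - u g d) - (u g t - u g d) = u f t - u g t"
      by simp
    with bound have "norm (u f t - u g t) \<le> \<eta> + 4 * \<eta> + \<eta>"
      by (simp only:)
    then show "norm (u f t - u g t) \<le> e"
      using e by (simp add: \<eta>_def)
  qed
  show thesis
    by (rule finite_net_from_labels[OF fin same that])
qed

section \<open>Continuous functions as elements of \<open>L\<^sup>\<infinity>\<close>\<close>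

lemma norm_le_if_AE_norm_le:
  fixes g :: "real \<Rightarrow> 'x::real_normed_vector"
  assumes g: "continuous_on {a..b} g" and AE: "AE x in lebesgue_on {a..b}. norm (g x) \<le> c" and x: "a < x" "x < b"
  shows "norm (g x) \<le> c"
proof (rule ccontr)
  assume gx: "\<not> norm (g x) \<le> c"
  define S where "S = {a<..<b} \<inter> (\<lambda>x. norm (g x)) -` {c<..}"
  have "open S"
    unfolding S_def using g
    by (intro continuous_open_preimage continuous_on_norm) (auto intro: continuous_on_subset)
  moreover have "x \<in> S"
    using gx x by (simp add: S_def)
  moreover have "negligible S"
  proof -
    have "AE x in lebesgue. x \<in> {a..b} \<longrightarrow> norm (g x) \<le> c"
      using AE by (simp add: AE_restrict_space_iff)
    then have "AE x in lebesgue. x \<notin> S"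
      by eventually_elim (auto simp: S_def)
    then show ?thesis
      using \<open>open S\<close> by (subst (asm) AE_iff_null_sets[symmetric]) (auto simp: negligible_iff_null_sets)
  qed
  ultimately show False
    using open_not_negligible by blast
qed

text \<open>
  The simple functions are \<open>g\<close> evaluated at \<open>x\<close> rounded down to a multiple of \<open>1 / i\<close>. The rounded point
  may fall to the left of \<open>a\<close>, which is why \<open>g\<close> is continuous on the whole line.
\<close>

lemma bochner_measurable_continuous:
  fixes g :: "real \<Rightarrow> 'x::real_normed_vector"
  assumes g: "continuous_on UNIV g"
  shows "bochner_measurable (lebesgue_on {a..b}) g"
  unfolding bochner_measurable_def
proof (intro exI conjI allI)
  let ?M = "lebesgue_on {a..b}"
  let ?p = "\<lambda>(i::nat) x. \<lfloor>real i * x\<rfloor>"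
  show "simple_function ?M (\<lambda>x. g (of_int (?p i x) / real i))" for i
  proof (rule simple_function_compose1[where f = "?p i" and g = "\<lambda>k. g (of_int k / real i)"])
    have p: "?p i \<in> measurable ?M (count_space UNIV)"
      by (rule measurable_compose[OF continuous_imp_measurable_on_sets_lebesgue measurable_real_floor])
        (auto intro!: continuous_intros)
    have "?p i ` {a..b} \<subseteq> {?p i a..?p i b}"
      by (auto intro!: floor_mono mult_left_mono)
    then have "finite (?p i ` space ?M)"
      by (simp add: finite_subset)
    then show "simple_function ?M (?p i)"
      unfolding simple_function_def by (intro conjI ballI measurable_sets[OF p]) auto
  qed
  show "AE x in ?M. (\<lambda>i. g (of_int (?p i x) / real i)) \<longlonglongrightarrow> g x"
  proof (rule AE_I2)
    fix x
    have "(\<lambda>i. of_int (?p i x) / real i) \<longlonglongrightarrow> x"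
    proof (rule tendsto_sandwich)
      show "eventually (\<lambda>i. x - 1 / real i \<le> of_int (?p i x) / real i) sequentially"
        using eventually_gt_at_top[of 0]
      proof eventually_elim
        case (elim i)
        have "(real i * x - 1) / real i \<le> of_int (?p i x) / real i"
          using elim by (intro divide_right_mono) linarith+
        then show ?case using elim by (simp add: diff_divide_distrib)
      qed
      show "eventually (\<lambda>i. of_int (?p i x) / real i \<le> x) sequentially"
        using eventually_gt_at_top[of 0] by eventually_elim (simp add: divide_le_eq mult.commute)
      show "(\<lambda>i. x - 1 / real i) \<longlonglongrightarrow> x"
        using tendsto_diff[OF tendsto_const lim_1_over_n, of x] by simp
    qed simp
    then show "(\<lambda>i. g (of_int (?p i x) / real i)) \<longlonglongrightarrow> g x"
      by (intro continuous_on_tendsto_compose[OF g]) auto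
  qed
qed

text \<open>
  Bounded continuous functions on the whole line form a complete space as a type; this map carries
  them to \<open>L\<^sup>\<infinity>\<close> of the interval and does not increase distances.
\<close>

definition Linf_class :: "real measure \<Rightarrow> (real \<Rightarrow>\<^sub>C 'x::real_normed_vector) \<Rightarrow> (real \<Rightarrow> 'x) set" where
  "Linf_class M g = linf_rel M `` {apply_bcontfun g}"

lemma bcontfun_in_linf_funs:
  fixes g :: "real \<Rightarrow>\<^sub>C 'x::real_normed_vector"
  assumes "a < b"
  shows "apply_bcontfun g \<in> linf_funs (lebesgue_on {a..b})"
  using norm_bounded[of g]
  by (intro linf_norm_I(1)[OF assms refl, of _ "norm g"] bochner_measurable_continuous) auto

lemma Linf_class:
  fixes g h :: "real \<Rightarrow>\<^sub>C 'x::real_normed_vector"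
  assumes ab: "a < b" and M: "M = lebesgue_on {a..b}"
  shows Linf_class_in_Linf: "Linf_class M g \<in> Linf M"
    and Linf_class_self: "apply_bcontfun g \<in> Linf_class M g"
    and Linf_dist_class_le: "Linf_dist M (Linf_class M g) (Linf_class M h) \<le> dist g h"
proof -
  have cls: "Linf_class M k \<in> Linf M \<and> apply_bcontfun k \<in> Linf_class M k" for k :: "real \<Rightarrow>\<^sub>C 'x"
  proof
    have k: "apply_bcontfun k \<in> linf_funs M"
      unfolding M by (rule bcontfun_in_linf_funs[OF ab])
    show "Linf_class M k \<in> Linf M"
      unfolding Linf_class_def Linf_def using k by (rule quotientI)
    show "apply_bcontfun k \<in> Linf_class M k"
      unfolding Linf_class_def using k by (rule equiv_class_self[OF equiv_linf_rel])
  qed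
  then show "Linf_class M g \<in> Linf M" "apply_bcontfun g \<in> Linf_class M g" by auto
  have "Linf_dist M (Linf_class M g) (Linf_class M h) = linf_norm M (\<lambda>x. g x - h x)"
    using cls by (intro Linf_dist_eq[OF ab M]) auto
  also have "\<dots> \<le> dist g h"
    using linf_diff[OF ab M bcontfun_in_linf_funs[OF ab, folded M] bcontfun_in_linf_funs[OF ab, folded M], of g h]
      dist_bounded[of g _ h]
    by (intro linf_norm_I(2)[OF ab M]) (auto simp: linf_funs_def dist_norm)
  finally show "Linf_dist M (Linf_class M g) (Linf_class M h) \<le> dist g h" .
qed

text \<open>
  Compactness is transported from the complete space of continuous functions: the image of a compact
  set is compact, hence closed in the metric space \<open>L\<^sup>\<infinity>\<close>, and so contains the closure of \<open>S\<close>.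
\<close>

lemma relatively_compactin_Linf_class:
  fixes G :: "(real \<Rightarrow>\<^sub>C 'x::real_normed_vector) set"
  assumes ab: "a < b" and M: "M = lebesgue_on {a..b}" and G: "compact (closure G)" and S: "S \<subseteq> Linf_class M ` G"
  shows "relatively_compactin (Metric_space.mtopology (Linf M) (Linf_dist M)) S"
proof -
  interpret L: Metric_space "Linf M :: (real \<Rightarrow> 'x) set set" "Linf_dist M"
    by (rule Metric_space_Linf[OF ab M])
  let ?c = "Linf_class M :: (real \<Rightarrow>\<^sub>C 'x) \<Rightarrow> _"
  have "continuous_map euclidean L.mtopology ?c"
    unfolding L.continuous_map_to_metric
  proof (intro ballI allI impI)
    fix g and \<epsilon> :: real assume "0 < \<epsilon>"
    have "?c h \<in> L.mball (?c g) \<epsilon>" if "h \<in> ball g \<epsilon>" for h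
      using that Linf_class_in_Linf[OF ab M, of g] Linf_class_in_Linf[OF ab M, of h]
        le_less_trans[OF Linf_dist_class_le[OF ab M, of g h]]
      by (simp add: L.in_mball)
    with \<open>0 < \<epsilon>\<close> show "\<exists>U. openin euclidean U \<and> g \<in> U \<and> (\<forall>h\<in>U. ?c h \<in> L.mball (?c g) \<epsilon>)"
      by (intro exI[of _ "ball g \<epsilon>"]) auto
  qed
  then have comp: "compactin L.mtopology (?c ` closure G)"
    using G by (intro image_compactin) auto
  then have closed: "closedin L.mtopology (?c ` closure G)"
    by (rule compactin_imp_closedin[OF L.Hausdorff_space_mtopology])
  have sub: "S \<subseteq> ?c ` closure G"
    using S closure_subset by blast
  then have "compactin L.mtopology (L.mtopology closure_of S)"
    using closed_compactin[OF comp closure_of_minimal[OF sub closed]] by simp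
  then show ?thesis
    using sub closedin_subset[OF closed] by (auto simp: relatively_compactin_def)
qed

lemma mbounded_Linf_AE_bound:
  fixes F :: "(real \<Rightarrow> 'x::real_normed_vector) set set"
  assumes ab: "a < b" and M: "M = lebesgue_on {a..b}" and F: "Metric_space.mbounded (Linf M) (Linf_dist M) F"
  obtains c where "0 \<le> c" "\<And>f. f \<in> \<Union>F \<Longrightarrow> bochner_measurable M f \<and> (AE x in M. norm (f x) \<le> c)"
proof -
  interpret L: Metric_space "Linf M :: (real \<Rightarrow> 'x) set set" "Linf_dist M"
    by (rule Metric_space_Linf[OF ab M])
  obtain A0 r where F0: "F \<subseteq> L.mcball A0 r"
    using F by (auto simp: L.mbounded_def)
  show thesis
  proof (cases "F = {}")
    case True
    then show thesis by (intro that[of 0]) auto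
  next
    case False
    then have A0: "A0 \<in> Linf M"
      using F0 by (auto simp: L.in_mcball)
    obtain g where g: "g \<in> A0" "g \<in> linf_funs M"
      using Linf_rep(1)[OF A0] subsetD[OF Linf_rep(2)[OF A0]] by blast
    have bd: "bochner_measurable M f \<and> (AE x in M. norm (f x) \<le> linf_norm M g + r)" if f: "f \<in> \<Union>F" for f
    proof -
      obtain A where A: "A \<in> F" "f \<in> A" using f by blast
      then have AL: "A \<in> Linf M" "Linf_dist M A0 A \<le> r"
        using F0 by (auto simp: L.in_mcball)
      have fl: "f \<in> linf_funs M"
        using subsetD[OF Linf_rep(2)[OF AL(1)] A(2)] .
      have r: "linf_norm M (\<lambda>x. g x - f x) \<le> r"
        using AL Linf_dist_eq[OF ab M A0 AL(1) g(1) A(2)] by simp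
      from linf_norm_AE[OF ab M linf_diff[OF ab M g(2) fl]] linf_norm_AE[OF ab M g(2)]
      have "AE x in M. norm (f x) \<le> linf_norm M g + r"
      proof eventually_elim
        case (elim x)
        then show ?case
          using norm_triangle_ineq4[of "g x" "g x - f x"] r by simp
      qed
      then show ?thesis
        using fl by (simp add: linf_funs_def)
    qed
    have "AE x in M. norm (f x) \<le> max 0 (linf_norm M g + r)" if "f \<in> \<Union>F" for f
      using conjunct2[OF bd[OF that]] by eventually_elim simp
    then show thesis
      using bd by (intro that[of "max 0 (linf_norm M g + r)"]) auto
  qed
qed

text \<open>
  The extension \<open>h\<close> is given explicitly, constant beyond the ends of the interval, so that
  uniform estimates on \<open>{a..b}\<close> for several functions turn into estimates on the whole line.
\<close>

lemma continuous_on_imp_Linf_class: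
  fixes g :: "real \<Rightarrow> 'x::real_normed_vector"
  assumes ab: "a < b" and M: "M = lebesgue_on {a..b}" and g: "continuous_on {a..b} g"
  obtains h :: "real \<Rightarrow>\<^sub>C 'x" where "\<And>x. h x = g (clamp a b x)"
    "linf_rel M `` {g} = Linf_class M h" "g \<in> linf_funs M"
proof -
  obtain h :: "real \<Rightarrow>\<^sub>C 'x" where h: "\<And>x. x \<in> {a..b} \<Longrightarrow> h x = g x" "\<And>x. h x = g (clamp a b x)"
    using continuous_on_cbox_bcontfunE[of a b g] g by (metis box_real(2))
  have AE: "AE x in M. h x = g x"
    using h(1) by (intro AE_I2) (simp add: M)
  have "g \<in> linf_funs M"
  proof (rule linf_norm_I(1)[OF ab M])
    show "bochner_measurable M g"
      using AE bochner_measurable_continuous[of h a b] by (intro bochner_measurable_cong_AE[OF AE]) (simp add: M)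
    show "AE x in M. norm (g x) \<le> norm h"
      using AE
    proof eventually_elim
      case (elim x)
      then show ?case using norm_bounded[of h x] by simp
    qed
  qed
  moreover have "(g, apply_bcontfun h) \<in> linf_rel M"
  proof -
    have "AE x in M. g x = h x"
      using AE by eventually_elim simp
    then show ?thesis
      using calculation bcontfun_in_linf_funs[OF ab, of h, folded M] by (simp add: linf_rel_def)
  qed
  then have "linf_rel M `` {g} = Linf_class M h"
    unfolding Linf_class_def by (rule equiv_class_eq[OF equiv_linf_rel])
  ultimately show thesis
    using that h(2) by blast
qed

section \<open>Compactness of the fractional integral operator\<close>

text \<open>
  The uniform net from the Arzela-Ascoli argument is a net in the supremum norm for the continuous
  extensions \<open>B f\<close> of \<open>J\<^sup>\<alpha> f\<close> to the whole line. Any representative \<open>f\<close> of a class in \<open>F\<close> may be taken, since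
  the image class depends only on the class.
\<close>

lemma rl_operator_image_compact_if_increments_compact:
  fixes F :: "(real \<Rightarrow> 'x::banach) set set"
  assumes ab: "a < b" and \<alpha>: "0 < \<alpha>" and M: "M = lebesgue_on {a..b}"
    and F: "Metric_space.mbounded (Linf M) (Linf_dist M) F"
    and comp: "\<And>p q. a < p \<Longrightarrow> p < q \<Longrightarrow> q < b \<Longrightarrow>
      compact (closure {rl_integral a (1 + \<alpha>) f q - rl_integral a (1 + \<alpha>) f p | f. f \<in> \<Union>F})"
  shows "relatively_compactin (Metric_space.mtopology (Linf M) (Linf_dist M)) (rl_operator a b \<alpha> ` F)"
proof -
  interpret L: Metric_space "Linf M :: (real \<Rightarrow> 'x) set set" "Linf_dist M"
    by (rule Metric_space_Linf[OF ab M])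
  let ?u = "rl_integral a \<alpha> :: (real \<Rightarrow> 'x) \<Rightarrow> _" and ?w = "rl_integral a (1 + \<alpha>) :: (real \<Rightarrow> 'x) \<Rightarrow> _"
  obtain c where c: "0 \<le> c" and fc: "\<And>f. f \<in> \<Union>F \<Longrightarrow> bochner_measurable M f \<and> (AE x in M. norm (f x) \<le> c)"
    using mbounded_Linf_AE_bound[OF ab M F] by metis
  have "\<exists>h. (\<forall>x. apply_bcontfun h x = ?u f (clamp a b x)) \<and> linf_rel M `` {?u f} = Linf_class M h" if "f \<in> \<Union>F" for f
    using continuous_on_imp_Linf_class[OF ab M continuous_on_rl_integral[OF \<alpha> c]] fc[OF that] M by metis
  then obtain B where B: "\<And>f x. f \<in> \<Union>F \<Longrightarrow> apply_bcontfun (B f) x = ?u f (clamp a b x)"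
      "\<And>f. f \<in> \<Union>F \<Longrightarrow> linf_rel M `` {?u f} = Linf_class M (B f)"
    by metis
  have equi: "\<exists>\<delta>>0. \<forall>f\<in>\<Union>F. \<forall>t\<in>{a..b}. \<forall>\<tau>\<in>{a..b}. \<bar>\<tau> - t\<bar> < \<delta> \<longrightarrow>
      norm (?u f \<tau> - ?u f t) \<le> \<epsilon> \<and> norm (?w f \<tau> - ?w f t - (\<tau> - t) *\<^sub>R ?u f t) \<le> \<epsilon> * \<bar>\<tau> - t\<bar>" if \<epsilon>: "0 < \<epsilon>" for \<epsilon>
  proof -
    obtain \<delta> where "0 < \<delta>" and \<delta>: "\<And>(f :: real \<Rightarrow> 'x) t \<tau>. bochner_measurable M f \<Longrightarrow> AE s in M. norm (f s) \<le> c \<Longrightarrow>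
      t \<in> {a..b} \<Longrightarrow> \<tau> \<in> {a..b} \<Longrightarrow> \<bar>\<tau> - t\<bar> < \<delta> \<Longrightarrow>
      norm (?u f \<tau> - ?u f t) \<le> \<epsilon> \<and> norm (?w f \<tau> - ?w f t - (\<tau> - t) *\<^sub>R ?u f t) \<le> \<epsilon> * \<bar>\<tau> - t\<bar>"
      by (rule rl_integral_equicontinuous_derivative[OF \<alpha> c \<epsilon>, of a b, folded M]) (rule that)
    show ?thesis
    proof (intro exI conjI ballI impI)
      fix f t \<tau> assume "f \<in> \<Union>F" "t \<in> {a..b}" "\<tau> \<in> {a..b}" "\<bar>\<tau> - t\<bar> < \<delta>"
      note * = \<delta>[OF conjunct1[OF fc[OF this(1)]] conjunct2[OF fc[OF this(1)]] this(2-4)]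
      show "norm (?u f \<tau> - ?u f t) \<le> \<epsilon>" "norm (?w f \<tau> - ?w f t - (\<tau> - t) *\<^sub>R ?u f t) \<le> \<epsilon> * \<bar>\<tau> - t\<bar>"
        using * by auto
    qed fact
  qed
  have "compact (closure (B ` \<Union>F))"
  proof (rule compact_closure_if_totally_bounded)
    fix e :: real assume e: "0 < e"
    then have "0 < e / 2" by simp
    from finite_uniform_net_if_increments_compact[OF ab equi comp this]
    obtain K where K: "finite K" "K \<subseteq> \<Union>F"
      "\<And>f. f \<in> \<Union>F \<Longrightarrow> \<exists>g\<in>K. \<forall>t\<in>{a..b}. norm (?u f t - ?u g t) \<le> e / 2" by blast
    have "\<exists>g\<in>K. dist (B g) (B f) < e" if f: "f \<in> \<Union>F" for f
    proof -
      obtain g where g: "g \<in> K" "\<forall>t\<in>{a..b}. norm (?u f t - ?u g t) \<le> e / 2"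
        using K(3)[OF f] by blast
      have "dist (B g) (B f) \<le> e / 2"
      proof (rule dist_bound)
        fix x
        have "clamp a b x \<in> {a..b}"
          using clamp_in_interval[of a b x] ab by simp
        then show "dist (B g x) (B f x) \<le> e / 2"
          using g(2) B(1)[OF f] B(1)[OF subsetD[OF K(2) g(1)]] by (simp add: dist_norm norm_minus_commute)
      qed
      then show ?thesis
        using g(1) e by (intro bexI[of _ g]) auto
    qed
    then show "\<exists>K. finite K \<and> B ` \<Union>F \<subseteq> (\<Union>x\<in>K. ball x e)"
      using K(1) by (intro exI[of _ "B ` K"]) fastforce
  qed
  moreover have "rl_operator a b \<alpha> ` F \<subseteq> Linf_class M ` B ` \<Union>F"
  proof
    fix T assume "T \<in> rl_operator a b \<alpha> ` F"
    then obtain A where A: "A \<in> F" "T = rl_operator a b \<alpha> A" by blast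
    have AL: "A \<in> Linf M"
      using A(1) L.mbounded_subset_mspace[OF F] by blast
    obtain f where f: "f \<in> A"
      by (rule that[OF Linf_rep(1)[OF AL]])
    have "T = linf_rel M `` {?u f}"
      using rl_operator_rep[OF AL[unfolded M] f] A(2) M by simp
    then show "T \<in> Linf_class M ` B ` \<Union>F"
      using B(2) A(1) f by blast
  qed
  ultimately show ?thesis
    by (rule relatively_compactin_Linf_class[OF ab M])
qed

text \<open>
  A finite net for the images under \<open>J\<^sup>\<alpha>\<close> in the \<open>L\<^sup>\<infinity>\<close> norm is a finite net for the derivatives of the
  functions \<open>J\<^bsup>1 + \<alpha>\<^esup> f\<close>, first almost everywhere and then, by continuity, at every interior point. The mean
  value inequality turns it into a finite net for the increments.
\<close>

lemma increments_compact_if_rl_operator_image_compact: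
  fixes F :: "(real \<Rightarrow> 'x::banach) set set"
  assumes ab: "a < b" and \<alpha>: "0 < \<alpha>" and M: "M = lebesgue_on {a..b}"
    and F: "Metric_space.mbounded (Linf M) (Linf_dist M) F"
    and comp: "relatively_compactin (Metric_space.mtopology (Linf M) (Linf_dist M)) (rl_operator a b \<alpha> ` F)"
    and pq: "a < p" "p < q" "q < b"
  shows "compact (closure {rl_integral a (1 + \<alpha>) f q - rl_integral a (1 + \<alpha>) f p | f. f \<in> \<Union>F})"
proof (rule compact_closure_if_totally_bounded)
  interpret L: Metric_space "Linf M :: (real \<Rightarrow> 'x) set set" "Linf_dist M"
    by (rule Metric_space_Linf[OF ab M])
  let ?T = "rl_operator a b \<alpha> :: (real \<Rightarrow> 'x) set \<Rightarrow> _"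
  let ?u = "rl_integral a \<alpha> :: (real \<Rightarrow> 'x) \<Rightarrow> _" and ?w = "rl_integral a (1 + \<alpha>) :: (real \<Rightarrow> 'x) \<Rightarrow> _"
  fix e :: real assume e: "0 < e"
  obtain c where c: "0 \<le> c" and fc: "\<And>f. f \<in> \<Union>F \<Longrightarrow> bochner_measurable M f \<and> (AE x in M. norm (f x) \<le> c)"
    using mbounded_Linf_AE_bound[OF ab M F] by metis
  have FL: "F \<subseteq> Linf M"
    by (rule L.mbounded_subset_mspace[OF F])
  have cont: "continuous_on {a..b} (?u f)" if "f \<in> \<Union>F" for f
    using fc[OF that, unfolded M] by (intro continuous_on_rl_integral[OF \<alpha> c]) auto
  have lf: "?u f \<in> linf_funs M" if "f \<in> \<Union>F" for f
    using continuous_on_imp_Linf_class[OF ab M cont[OF that]] by blast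
  have TA: "?T A \<in> Linf M" "?u f \<in> ?T A" if "A \<in> F" "f \<in> A" for A f
  proof -
    have "?T A = linf_rel M `` {?u f}"
      using rl_operator_rep[of A a b f \<alpha>] that FL unfolding M by blast
    moreover have "?u f \<in> linf_funs M"
      using lf that by blast
    ultimately show "?T A \<in> Linf M" "?u f \<in> ?T A"
      using quotientI[of "?u f" "linf_funs M" "linf_rel M"] equiv_class_self[OF equiv_linf_rel, of "?u f" M]
      by (simp_all add: Linf_def)
  qed
  \<comment> \<open>the mean value inequality over \<open>{p..q}\<close> multiplies the distance by \<open>q - p\<close>\<close>
  define \<eta> where "\<eta> = e / (2 * (q - p))"
  have \<eta>: "0 < \<eta>"
    using e pq by (simp add: \<eta>_def)
  have tb: "L.mtotally_bounded (?T ` F)"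
  proof (rule L.mtotally_bounded_subset)
    show "L.mtotally_bounded (L.mtopology closure_of ?T ` F)"
      using comp by (intro L.compactin_imp_mtotally_bounded) (simp add: relatively_compactin_def)
    show "?T ` F \<subseteq> L.mtopology closure_of ?T ` F"
      using comp by (intro closure_of_subset) (simp add: relatively_compactin_def)
  qed
  from tb[unfolded L.mtotally_bounded_def, rule_format, OF \<eta>]
  obtain K where K: "finite K" "K \<subseteq> ?T ` F" "?T ` F \<subseteq> (\<Union>x\<in>K. L.mball x \<eta>)"
    by (elim exE conjE) (rule that)
  obtain K' where K': "K' \<subseteq> F" "finite K'" "K = ?T ` K'"
    using K(1,2) finite_subset_image[of K ?T F] by metis
  let ?r = "\<lambda>A. SOME f. f \<in> A"
  let ?P = "(\<lambda>A. ?w (?r A) q - ?w (?r A) p) ` K'"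
  have "\<exists>x\<in>?P. dist x (?w f q - ?w f p) < e" if f: "f \<in> \<Union>F" for f
  proof -
    obtain A where A: "A \<in> F" "f \<in> A" using f by blast
    obtain A' where A': "A' \<in> K'" "Linf_dist M (?T A') (?T A) < \<eta>"
      using K(3) K'(3) A(1) by (auto simp: L.in_mball)
    then have A'F: "A' \<in> F" using K'(1) by blast
    define g where "g = ?r A'"
    have g: "g \<in> A'"
      unfolding g_def by (rule Linf_rep(1)[OF subsetD[OF FL A'F]])
    then have gF: "g \<in> \<Union>F" using A'F by blast
    have norm_less: "linf_norm M (\<lambda>x. ?u g x - ?u f x) < \<eta>"
      using A'(2) Linf_dist_eq[OF ab M TA(1)[OF A'F g] TA(1)[OF A] TA(2)[OF A'F g] TA(2)[OF A]] by simp
    have AE: "AE x in M. norm (?u g x - ?u f x) \<le> \<eta>"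
      using linf_norm_AE[OF ab M linf_diff[OF ab M lf[OF gF] lf[OF f]]]
      by eventually_elim (use norm_less in linarith)
    have le: "norm (?u g x - ?u f x) \<le> \<eta>" if "x \<in> {p..q}" for x
      by (rule norm_le_if_AE_norm_le[OF continuous_on_diff[OF cont[OF gF] cont[OF f]] AE[unfolded M]])
        (use that pq in auto)
    have deriv: "((\<lambda>x. ?w g x - ?w f x) has_derivative (\<lambda>h. h *\<^sub>R (?u g x - ?u f x))) (at x within {p..q})"
      if "x \<in> {p..q}" for x
    proof -
      have d: "(?w k has_vector_derivative ?u k x) (at x within {p..q})" if "k \<in> \<Union>F" for k
      proof (rule has_vector_derivative_within_subset)
        show "(?w k has_vector_derivative ?u k x) (at x within {a..b})"
          using fc[OF that, unfolded M] \<open>x \<in> {p..q}\<close> pq by (intro rl_integral_has_vector_derivative[OF \<alpha> c]) auto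
      qed (use pq in auto)
      from has_vector_derivative_diff[OF d[OF gF] d[OF f]] show ?thesis
        by (simp add: has_vector_derivative_def)
    qed
    have "norm ((?w g q - ?w f q) - (?w g p - ?w f p)) \<le> \<eta> * norm (q - p)"
    proof (rule differentiable_bound[OF _ deriv])
      fix x assume "x \<in> {p..q}"
      then show "onorm (\<lambda>h. h *\<^sub>R (?u g x - ?u f x)) \<le> \<eta>"
        using le by (simp add: onorm_scaleR_left[OF bounded_linear_ident] onorm_id)
    qed (use pq in auto)
    also have "\<dots> < e"
    proof -
      have "e / (2 * x) * x < e" if "0 < x" for x :: real
        using that e by simp
      from this[of "q - p"] show ?thesis
        using pq by (simp add: \<eta>_def del: right_diff_distrib')
    qed
    finally have "dist (?w g q - ?w g p) (?w f q - ?w f p) < e"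
      by (simp add: dist_norm algebra_simps)
    then show ?thesis
      using A'(1) by (auto simp: g_def)
  qed
  then show "\<exists>K. finite K \<and> {?w f q - ?w f p | f. f \<in> \<Union>F} \<subseteq> (\<Union>x\<in>K. ball x e)"
    using K'(2) by (intro exI[of _ ?P] conjI finite_imageI) fastforce+
qed

theorem theorem19:
  fixes t0 t1 \<alpha> :: real
  assumes "t0 < t1" and "\<alpha> > 0"
  shows "compact_operator
           (Linf (lebesgue_on {t0..t1})) (Linf_dist (lebesgue_on {t0..t1}))
           (Linf (lebesgue_on {t0..t1})) (Linf_dist (lebesgue_on {t0..t1}))
           (rl_operator t0 t1 \<alpha> :: (real \<Rightarrow> 'x::banach) set \<Rightarrow> (real \<Rightarrow> 'x) set)
     \<longleftrightarrow>
         (\<forall>F :: (real \<Rightarrow> 'x) set set. \<forall>a b.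
            Metric_space.mbounded (Linf (lebesgue_on {t0..t1})) (Linf_dist (lebesgue_on {t0..t1})) F
            \<and> t0 < a \<and> a < b \<and> b < t1
            \<longrightarrow> compact (closure {rl_integral t0 (1 + \<alpha>) f b - rl_integral t0 (1 + \<alpha>) f a | f. f \<in> \<Union>F}))"
proof (intro iffI allI impI; (elim conjE)?)
  fix F :: "(real \<Rightarrow> 'x) set set" and a b
  assume "compact_operator
           (Linf (lebesgue_on {t0..t1})) (Linf_dist (lebesgue_on {t0..t1}))
           (Linf (lebesgue_on {t0..t1})) (Linf_dist (lebesgue_on {t0..t1}))
           (rl_operator t0 t1 \<alpha> :: (real \<Rightarrow> 'x) set \<Rightarrow> (real \<Rightarrow> 'x) set)"
    and F: "Metric_space.mbounded (Linf (lebesgue_on {t0..t1})) (Linf_dist (lebesgue_on {t0..t1})) F"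
    and ab: "t0 < a" "a < b" "b < t1"
  then show "compact (closure {rl_integral t0 (1 + \<alpha>) f b - rl_integral t0 (1 + \<alpha>) f a | f. f \<in> \<Union>F})"
    unfolding compact_operator_def
    by (intro increments_compact_if_rl_operator_image_compact[OF assms refl F _ ab]) blast
next
  assume "\<forall>F :: (real \<Rightarrow> 'x) set set. \<forall>a b.
            Metric_space.mbounded (Linf (lebesgue_on {t0..t1})) (Linf_dist (lebesgue_on {t0..t1})) F
            \<and> t0 < a \<and> a < b \<and> b < t1
            \<longrightarrow> compact (closure {rl_integral t0 (1 + \<alpha>) f b - rl_integral t0 (1 + \<alpha>) f a | f. f \<in> \<Union>F})"
  then show "compact_operator
           (Linf (lebesgue_on {t0..t1})) (Linf_dist (lebesgue_on {t0..t1}))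
           (Linf (lebesgue_on {t0..t1})) (Linf_dist (lebesgue_on {t0..t1}))
           (rl_operator t0 t1 \<alpha> :: (real \<Rightarrow> 'x) set \<Rightarrow> (real \<Rightarrow> 'x) set)"
    unfolding compact_operator_def
    by (intro allI impI rl_operator_image_compact_if_increments_compact[OF assms refl]) blast+
qed

end
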